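(* Let $G$ be a connected graph for which there are integer constants $2<k_1<k_2$ such that every vertex of $G$ has degree $2$, $k_1$, or $k_2$. Suppose further that there is a finite constant $L>0$ such that every path in $G$ all of whose vertices have degree $2$ has length at most $L$. Let $G'$ be the graph whose vertex set $V$ is the set of all vertices of $G$ of degree different from $2$ (i.e. of degree $k_1$ or $k_2$), with two vertices of $V$ adjacent in $G'$ if they are adjacent in $G$ or if there is a path of vertices of degree $2$ connecting them in $G$. Suppose that $G'$ is infinite, that every vertex of $G'$ has degree (in $G'$) either $k_1$ or $k_2$, that every vertex of degree $k_1$ in $G'$ is adjacent in $G'$ only to vertices of degree $k_2$ in $G'$, and that every vertex of degree $k_2$ in $G'$ is adjacent in $G'$ only to vertices of degree $k_1$ in $G'$. Then non-backtracking random walk is recurrent on $G$ if and only if simple random walk is recurrent on $G$.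
   Context: Graphs are undirected, and $G$ is simple; $x\sim y$ means that $x$ and $y$ are adjacent, and $\deg(x)$ is the number of neighbours of $x$. Paths do not repeat vertices. Two vertices $u,w\in V$ are connected by a path of vertices of degree $2$ if there is a path in $G$ from $u$ to $w$ all of whose interior vertices have degree $2$ in $G$. Simple random walk on $G$ is the Markov chain on the vertices of $G$ which from a vertex $x$ moves to each neighbour of $x$ with probability $1/\deg(x)$. Non-backtracking random walk on $G$ is the random process $(X_n)_{n\ge 0}$ on the vertices of $G$ with transition probabilities $P(X_1=y\mid X_0=x)=\frac{1}{\deg(x)}$ if $y\sim x$ and $0$ otherwise, and, for $n\ge 1$, conditionally on the past up to time $n$ with $X_{n-1}=x_1$ and $X_n=x_2$, $P(X_{n+1}=y\mid X_n=x_2, X_{n-1}=x_1)=\frac{1}{\deg(x_2)-1}$ if $y\sim x_2$ and $y\ne x_1$, and $0$ if $y\not\sim x_2$ or $y=x_1$. A walk (simple or non-backtracking) is recurrent on $G$ if, for every starting vertex $v$, the walk started at $X_0=v$ almost surely visits $v$ infinitely often. *)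

theory Defs
  imports "Graph_Theory.Graph_Theory" "HOL-Probability.Probability"
begin

section \<open>Graphs\<close>

text \<open>
  A (possibly infinite) simple undirected graph is a \<open>pair_pre_digraph\<close> satisfying
  \<open>pair_bidirected_digraph\<close> (well-formed, symmetric, loop-free): each undirected edge is
  represented by its two orientations. Paths are \<open>pre_digraph.apath\<close> (no repeated vertices);
  the length of a path is the length of its list of arcs.
\<close>

definition neighbours :: "'a pair_pre_digraph \<Rightarrow> 'a \<Rightarrow> 'a set" where
  "neighbours G x = {y. (x, y) \<in> parcs G}"

text \<open>A vertex with infinitely many neighbours gets the value \<open>0\<close>.\<close>

definition deg :: "'a pair_pre_digraph \<Rightarrow> 'a \<Rightarrow> nat" where
  "deg G x = card (neighbours G x)"

definition deg2_connected :: "'a pair_pre_digraph \<Rightarrow> 'a \<Rightarrow> 'a \<Rightarrow> bool" where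
  "deg2_connected G u w \<longleftrightarrow>
     (\<exists>p. pre_digraph.apath (with_proj G) u p w \<and>
          (\<forall>x \<in> set (pre_digraph.inner_verts (with_proj G) p). deg G x = 2))"

text \<open>
  The condition \<open>u \<noteq> w\<close> excludes the path of length \<open>0\<close>, which would otherwise
  make every vertex adjacent to itself.
\<close>

definition branch_graph :: "'a pair_pre_digraph \<Rightarrow> 'a pair_pre_digraph" where
  "branch_graph G =
     (let V = {x \<in> pverts G. deg G x \<noteq> 2} in
      \<lparr> pverts = V,
        parcs = {(u, w). u \<in> V \<and> w \<in> V \<and> u \<noteq> w \<and> ((u, w) \<in> parcs G \<or> deg2_connected G u w)} \<rparr>)"


section \<open>Random walks\<close>

text \<open>
  The argument \<open>K n h\<close> of \<open>walk_law\<close> is the conditional distribution of the position at time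
  \<open>n\<close> given the history \<open>h 0, \<dots>, h (n - 1)\<close>. The law is the Ionescu-Tulcea measure on the space of
  all trajectories; for the two walks below this measure is characterised by the lemmas
  \<open>srw_law_step\<close> and \<open>nbrw_law_step\<close>.
\<close>

definition walk_law ::
  "'a pair_pre_digraph \<Rightarrow> (nat \<Rightarrow> (nat \<Rightarrow> 'a) \<Rightarrow> 'a measure) \<Rightarrow> (nat \<Rightarrow> 'a) measure" where
  "walk_law G K =
     (let M = (\<lambda>_. count_space (pverts G))
      in projective_family.lim UNIV (Ionescu_Tulcea.CI K M) M)"

definition srw_prob :: "'a pair_pre_digraph \<Rightarrow> 'a \<Rightarrow> 'a \<Rightarrow> real" where
  "srw_prob G x y = (if (x, y) \<in> parcs G then 1 / real (deg G x) else 0)"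

definition nbrw_prob :: "'a pair_pre_digraph \<Rightarrow> 'a \<Rightarrow> 'a \<Rightarrow> 'a \<Rightarrow> real" where
  "nbrw_prob G x1 x2 y =
     (if (x2, y) \<in> parcs G \<and> y \<noteq> x1 then 1 / (real (deg G x2) - 1) else 0)"

fun srw_kernel :: "'a pair_pre_digraph \<Rightarrow> 'a \<Rightarrow> nat \<Rightarrow> (nat \<Rightarrow> 'a) \<Rightarrow> 'a measure" where
  "srw_kernel G v 0 h = return (count_space (pverts G)) v"
| "srw_kernel G v (Suc n) h = point_measure (pverts G) (\<lambda>y. ennreal (srw_prob G (h n) y))"

text \<open>
  The Ionescu-Tulcea construction needs a probability measure after every history, including
  those of probability \<open>0\<close> in which two consecutive positions are not adjacent. The \<open>else\<close>
  branch below only serves this purpose and has no influence on the law.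
\<close>

fun nbrw_kernel :: "'a pair_pre_digraph \<Rightarrow> 'a \<Rightarrow> nat \<Rightarrow> (nat \<Rightarrow> 'a) \<Rightarrow> 'a measure" where
  "nbrw_kernel G v 0 h = return (count_space (pverts G)) v"
| "nbrw_kernel G v (Suc 0) h = point_measure (pverts G) (\<lambda>y. ennreal (srw_prob G (h 0) y))"
| "nbrw_kernel G v (Suc (Suc n)) h =
     point_measure (pverts G) (\<lambda>y. ennreal
       (if (h n, h (Suc n)) \<in> parcs G then nbrw_prob G (h n) (h (Suc n)) y
        else srw_prob G (h (Suc n)) y))"

definition srw_law :: "'a pair_pre_digraph \<Rightarrow> 'a \<Rightarrow> (nat \<Rightarrow> 'a) measure" where
  "srw_law G v = walk_law G (srw_kernel G v)"

definition nbrw_law :: "'a pair_pre_digraph \<Rightarrow> 'a \<Rightarrow> (nat \<Rightarrow> 'a) measure" where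
  "nbrw_law G v = walk_law G (nbrw_kernel G v)"

definition srw_recurrent :: "'a pair_pre_digraph \<Rightarrow> bool" where
  "srw_recurrent G \<longleftrightarrow>
     (\<forall>v \<in> pverts G. AE \<omega> in srw_law G v. infinite {n. \<omega> n = v})"

definition nbrw_recurrent :: "'a pair_pre_digraph \<Rightarrow> bool" where
  "nbrw_recurrent G \<longleftrightarrow>
     (\<forall>v \<in> pverts G. AE \<omega> in nbrw_law G v. infinite {n. \<omega> n = v})"


section \<open>Well-definedness of the walk laws\<close>

lemma countable_pverts:
  assumes G: "pair_bidirected_digraph G" "Digraph_Component.connected (with_proj G)"
    and fin: "\<And>x. x \<in> pverts G \<Longrightarrow> finite (neighbours G x)"
  shows "countable (pverts G)"
proof -
  interpret pair_bidirected_digraph G by (fact G(1))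
  have sc: "strongly_connected (with_proj G)"
    using symmetric_connected_imp_strongly_connected[OF pair_sym_arcs G(2)] .
  then obtain r where r: "r \<in> pverts G" by (auto simp: strongly_connected_def)
  define B where "B n = {y. (r, y) \<in> parcs G ^^ n}" for n
  have B: "countable (B n) \<and> B n \<subseteq> pverts G" for n
  proof (induction n)
    case 0
    then show ?case using r by (auto simp: B_def)
  next
    case (Suc n)
    have "B (Suc n) = (\<Union>x\<in>B n. neighbours G x)"
      by (auto simp: B_def neighbours_def)
    moreover have "countable (\<Union>x\<in>B n. neighbours G x)"
      using Suc fin by (intro countable_UN) (auto intro: countable_finite)
    ultimately show ?case
      by (auto simp: neighbours_def dest: in_arcsD2)
  qed
  have "pverts G \<subseteq> (\<Union>n. B n)"
  proof
    fix y assume "y \<in> pverts G"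
    then have "r \<rightarrow>\<^sup>*\<^bsub>with_proj G\<^esub> y" using sc r by (auto simp: strongly_connected_def)
    then have "(r, y) \<in> (parcs G)\<^sup>*" using reachable_rtranclI by fastforce
    then show "y \<in> (\<Union>n. B n)" by (auto simp: B_def rtrancl_power)
  qed
  then show ?thesis using B by (meson countable_UN countableI_type countable_subset)
qed

lemma prob_space_point_measure:
  assumes "finite A" "A \<noteq> {}" "A \<subseteq> V" "\<And>y. f y = (if y \<in> A then 1 / real (card A) else 0)"
  shows "prob_space (point_measure V (\<lambda>y. ennreal (f y)))"
proof
  have "emeasure (point_measure V (\<lambda>y. ennreal (f y))) V =
      (\<integral>\<^sup>+y. ennreal (f y) \<partial>count_space V)"
    unfolding point_measure_def by (subst emeasure_density) (auto intro!: nn_integral_cong)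
  also have "\<dots> = (\<Sum>y\<in>A. ennreal (f y))"
    using assms by (intro nn_integral_count_space') auto
  also have "\<dots> = ennreal (\<Sum>y\<in>A. f y)"
    using assms by (intro sum_ennreal) auto
  also have "\<dots> = 1"
    using assms by simp
  finally show "emeasure (point_measure V (\<lambda>y. ennreal (f y)))
      (space (point_measure V (\<lambda>y. ennreal (f y)))) = 1"
    by (simp add: space_point_measure)
qed

lemma (in Ionescu_Tulcea) prob_space_lim: "prob_space PF.lim"
proof
  have "emeasure PF.lim (PF.emb UNIV {} (space (PiM {} M))) = emeasure (CI {}) (space (PiM {} M))"
    by (rule lim) auto
  moreover have "PF.emb UNIV {} (space (PiM {} M)) = space PF.lim"
    by (auto simp: prod_emb_def space_PiM)
  moreover have "emeasure (CI {}) (space (PiM {} M)) = 1"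
    using prob_space.emeasure_space_1[OF PF.prob_space_P[of "{}"]] by (simp add: CI_def)
  ultimately show "emeasure PF.lim (space PF.lim) = 1" by simp
qed

lemma (in Ionescu_Tulcea) emeasure_lim_0:
  assumes sing: "{v} \<in> sets (M 0)"
  shows "emeasure PF.lim {\<omega> \<in> space PF.lim. \<omega> 0 = v} = emeasure (P 0 (\<lambda>_. undefined)) {v}"
proof -
  define B where "B = PiE {0::nat} (\<lambda>_. {v})"
  have B[measurable]: "B \<in> sets (PiM {0} M)"
    unfolding B_def using sing by (intro sets_PiM_I_finite) auto
  have B1[measurable]: "B \<in> sets (PiM {0..<Suc 0} M)" using B by simp
  have u: "(\<lambda>_. undefined) \<in> space (PiM {0..<0} M)" by (simp add: space_PiM)
  have "{\<omega> \<in> space PF.lim. \<omega> 0 = v} = PF.emb UNIV {0} B"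
    by (auto simp: B_def prod_emb_def space_PiM PiE_iff fun_eq_iff restrict_def split: if_splits)
  then have "emeasure PF.lim {\<omega> \<in> space PF.lim. \<omega> 0 = v} = emeasure (CI {0}) B"
    using B by (simp add: lim)
  also have "\<dots> = emeasure (C 0 (Suc 0) (\<lambda>_. undefined)) B"
    using B prod_emb_id[OF sets.sets_into_space[OF B, unfolded space_PiM]]
    by (subst emeasure_CI[of _ "Suc 0"]) (auto simp del: C.simps)
  also have "\<dots> = emeasure (eP 0 (\<lambda>_. undefined)) B"
    using u using bind_return[OF measurable_eP u] by simp
  also have "\<dots> = emeasure (P 0 (\<lambda>_. undefined)) ((\<lambda>y. fun_upd (\<lambda>_. undefined) 0 y) -` B \<inter> space (M 0))"
    by (rule emeasure_eP[OF u B1])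
  also have "(\<lambda>y. fun_upd (\<lambda>_. undefined) 0 y) -` B \<inter> space (M 0) = {v}"
    using sing sets.sets_into_space[OF sing] by (auto simp: B_def PiE_iff extensional_def fun_eq_iff split: if_splits)
  finally show ?thesis .
qed

lemma (in Ionescu_Tulcea) emeasure_lim_Suc:
  assumes sing: "\<And>i. {x i} \<in> sets (M i)"
  shows "emeasure PF.lim {\<omega> \<in> space PF.lim. \<forall>i\<le>Suc n. \<omega> i = x i} =
         emeasure PF.lim {\<omega> \<in> space PF.lim. \<forall>i\<le>n. \<omega> i = x i} *
         emeasure (P (Suc n) (restrict x {0..n})) {x (Suc n)}"
proof -
  define B where "B m = PiE {0..<m} (\<lambda>i. {x i})" for m :: nat
  have B_iff: "f \<in> B m \<longleftrightarrow> (\<forall>i<m. f i = x i) \<and> (\<forall>i\<ge>m. f i = undefined)" for f m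
    by (auto simp: B_def PiE_iff extensional_def)
  have B[measurable]: "B m \<in> sets (PiM {0..<m} M)" for m
    unfolding B_def using sing by (intro sets_PiM_I_finite) auto
  have emb: "{\<omega> \<in> space PF.lim. \<forall>i\<le>m. \<omega> i = x i} = PF.emb UNIV {0..<Suc m} (B (Suc m))" for m
    by (auto simp: B_def prod_emb_def space_PiM PiE_iff extensional_def less_Suc_eq_le)
  have lim_eq: "emeasure PF.lim {\<omega> \<in> space PF.lim. \<forall>i\<le>m. \<omega> i = x i}
      = emeasure (C 0 (Suc m) (\<lambda>_. undefined)) (B (Suc m))" for m
    unfolding emb using B[of "Suc m"]
    by (subst lim) (auto simp: emeasure_CI[of _ "Suc m"] prod_emb_id[OF sets.sets_into_space[OF B[of "Suc m"], unfolded space_PiM]]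
        simp del: C.simps)
  let ?C = "C 0 (Suc n) (\<lambda>_. undefined)"
  have u: "(\<lambda>_. undefined) \<in> space (PiM {0..<0} M)" by (simp add: space_PiM)
  have spC: "space ?C = space (PiM {0..<Suc n} M)" using space_C[OF u, of "Suc n"] by (simp del: C.simps)
  have setC: "sets ?C = sets (PiM {0..<Suc n} M)" using sets_C[OF u, of "Suc n"] by (simp del: C.simps)
  have "emeasure (C 0 (Suc (Suc n)) (\<lambda>_. undefined)) (B (Suc (Suc n))) =
      (\<integral>\<^sup>+\<omega>. emeasure (eP (Suc n) \<omega>) (B (Suc (Suc n))) \<partial>?C)"
    unfolding C.simps(2)[of 0 "Suc n"] add_0
    by (rule emeasure_bind[where N="PiM {0..<Suc (Suc n)} M"])
       (auto simp: spC measurable_cong_sets[OF setC refl] simp del: C.simps)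
  also have "\<dots> = (\<integral>\<^sup>+\<omega>. indicator (B (Suc n)) \<omega> *
      emeasure (P (Suc n) (restrict x {0..n})) {x (Suc n)} \<partial>?C)"
  proof (rule nn_integral_cong)
    fix \<omega> assume "\<omega> \<in> space ?C"
    then have w: "\<omega> \<in> space (PiM {0..<Suc n} M)" using spC by simp
    have "{x (Suc n)} \<subseteq> space (M (Suc n))" using sing[of "Suc n"] sets.sets_into_space by blast
    then have eq: "(\<lambda>y. fun_upd \<omega> (Suc n) y) -` B (Suc (Suc n)) \<inter> space (M (Suc n)) =
        (if \<omega> \<in> B (Suc n) then {x (Suc n)} else {})"
      using w by (auto simp: B_iff space_PiM PiE_iff extensional_def less_Suc_eq Suc_le_eq all_conj_distrib split: if_splits)
    have "\<omega> = restrict x {0..n}" if "\<omega> \<in> B (Suc n)"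
      using that by (auto simp: B_def PiE_iff extensional_def fun_eq_iff less_Suc_eq_le)
    then show "emeasure (eP (Suc n) \<omega>) (B (Suc (Suc n))) = indicator (B (Suc n)) \<omega> *
      emeasure (P (Suc n) (restrict x {0..n})) {x (Suc n)}"
      using emeasure_eP[OF w B] eq by (auto simp: indicator_def)
  qed
  also have "\<dots> = emeasure ?C (B (Suc n)) * emeasure (P (Suc n) (restrict x {0..n})) {x (Suc n)}"
    using borel_measurable_indicator[OF B[of "Suc n", folded setC]] B[of "Suc n", folded setC]
    by (subst nn_integral_multc) (auto simp del: C.simps)
  finally show ?thesis unfolding lim_eq .
qed


lemma emeasure_point_measure_singleton:
  "y \<in> V \<Longrightarrow> emeasure (point_measure V f) {y} = f y"
  by (subst emeasure_point_measure_finite2) auto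

lemma walk_law_eq:
  "walk_law G K = projective_family.lim UNIV (Ionescu_Tulcea.CI K (\<lambda>_. count_space (pverts G)))
     (\<lambda>_. count_space (pverts G))"
  by (simp add: walk_law_def Let_def)

lemma walk_law_props:
  assumes "Ionescu_Tulcea K (\<lambda>_. count_space (pverts G))"
  shows "prob_space (walk_law G K)"
    and "sets (walk_law G K) = sets (Pi\<^sub>M UNIV (\<lambda>_. count_space (pverts G)))"
    and "(\<And>i. x i \<in> pverts G) \<Longrightarrow>
      emeasure (walk_law G K) {\<omega> \<in> space (walk_law G K). \<forall>i\<le>Suc n. \<omega> i = x i} =
      emeasure (walk_law G K) {\<omega> \<in> space (walk_law G K). \<forall>i\<le>n. \<omega> i = x i} *
      emeasure (K (Suc n) (restrict x {0..n})) {x (Suc n)}"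
    and "v \<in> pverts G \<Longrightarrow>
      emeasure (walk_law G K) {\<omega> \<in> space (walk_law G K). \<omega> 0 = v} =
      emeasure (K 0 (\<lambda>_. undefined)) {v}"
proof -
  interpret IT: Ionescu_Tulcea K "\<lambda>_. count_space (pverts G)" by fact
  show "prob_space (walk_law G K)"
    unfolding walk_law_eq by (rule IT.prob_space_lim)
  show "sets (walk_law G K) = sets (Pi\<^sub>M UNIV (\<lambda>_. count_space (pverts G)))"
    unfolding walk_law_eq by simp
  show "(\<And>i. x i \<in> pverts G) \<Longrightarrow>
      emeasure (walk_law G K) {\<omega> \<in> space (walk_law G K). \<forall>i\<le>Suc n. \<omega> i = x i} =
      emeasure (walk_law G K) {\<omega> \<in> space (walk_law G K). \<forall>i\<le>n. \<omega> i = x i} *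
      emeasure (K (Suc n) (restrict x {0..n})) {x (Suc n)}"
    unfolding walk_law_eq by (rule IT.emeasure_lim_Suc) simp
  assume v: "v \<in> pverts G"
  show "emeasure (walk_law G K) {\<omega> \<in> space (walk_law G K). \<omega> 0 = v} =
      emeasure (K 0 (\<lambda>_. undefined)) {v}"
    unfolding walk_law_eq using IT.emeasure_lim_0[of v] v by simp
qed

lemma prob_space_srw_step:
  assumes G: "pair_wf_digraph G" and x: "deg G x > 0"
  shows "prob_space (point_measure (pverts G) (\<lambda>y. ennreal (srw_prob G x y)))"
proof (rule prob_space_point_measure)
  show "finite (neighbours G x)" "neighbours G x \<noteq> {}"
    using x by (auto simp: deg_def card_gt_0_iff)
  show "neighbours G x \<subseteq> pverts G"
    using pair_wf_digraph.in_arcsD2[OF G] by (auto simp: neighbours_def)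
qed (auto simp: srw_prob_def neighbours_def deg_def)

lemma prob_space_nbrw_step:
  assumes G: "pair_wf_digraph G" and x: "(x2, x1) \<in> parcs G" "deg G x2 > 1"
  shows "prob_space (point_measure (pverts G) (\<lambda>y. ennreal (nbrw_prob G x1 x2 y)))"
proof (rule prob_space_point_measure)
  let ?A = "neighbours G x2 - {x1}"
  have fin: "finite (neighbours G x2)"
    using x(2) by (metis deg_def card.infinite not_less_zero)
  have card: "card ?A = deg G x2 - 1"
    using x by (simp add: neighbours_def deg_def)
  show "finite ?A" using fin by simp
  show "?A \<noteq> {}" using card x(2) by (metis card.empty zero_less_diff less_irrefl)
  show "?A \<subseteq> pverts G"
    using pair_wf_digraph.in_arcsD2[OF G] by (auto simp: neighbours_def)
  show "nbrw_prob G x1 x2 y = (if y \<in> ?A then 1 / real (card ?A) else 0)" for y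
    using x(2) unfolding card by (auto simp: nbrw_prob_def neighbours_def of_nat_diff)
qed

lemma Ionescu_Tulcea_walk:
  assumes V: "countable V"
    and K0: "K 0 = (\<lambda>h. return (count_space V) v)" and v: "v \<in> V"
    and K: "\<And>n. K (Suc n) = (\<lambda>h. F n (h (n - 1)) (h n))"
    and F: "\<And>n x y. x \<in> V \<Longrightarrow> y \<in> V \<Longrightarrow> prob_space (F n x y) \<and> sets (F n x y) = Pow V"
  shows "Ionescu_Tulcea K (\<lambda>_. count_space V)"
proof (rule Ionescu_Tulcea.intro)
  have F': "F n x \<in> measurable (count_space V) (subprob_algebra (count_space V))" if "x \<in> V" for n x
    using F[OF that] by (auto simp: space_subprob_algebra intro: prob_space_imp_subprob_space)
  show "K i \<in> measurable (PiM {0..<i} (\<lambda>_. count_space V)) (subprob_algebra (count_space V))" for i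
  proof (cases i)
    case 0
    then show ?thesis using v unfolding K0 0
      by (intro measurable_const)
         (auto simp: space_subprob_algebra intro!: prob_space_imp_subprob_space prob_space_return)
  next
    case (Suc n)
    have comp: "(\<lambda>h. h j) \<in> measurable (PiM {0..<Suc n} (\<lambda>_. count_space V)) (count_space V)" if "j \<le> n" for j
      using that by (intro measurable_component_singleton) auto
    have "(\<lambda>h. F n (h (n - 1)) (h n))
        \<in> measurable (PiM {0..<Suc n} (\<lambda>_. count_space V)) (subprob_algebra (count_space V))"
      by (rule measurable_compose_countable'[OF _ comp V])
         (auto intro: measurable_compose[OF comp F'])
    then show ?thesis unfolding Suc K .
  qed
  fix i :: nat and h assume h: "h \<in> space (PiM {0..<i} (\<lambda>_. count_space V))"
  show "prob_space (K i h)"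
  proof (cases i)
    case 0
    then show ?thesis using v K0 by (simp add: prob_space_return)
  next
    case (Suc n)
    then have "h (n - 1) \<in> V" "h n \<in> V" using h by (auto simp: space_PiM PiE_iff)
    then show ?thesis using F Suc K by simp
  qed
qed

context
  fixes G :: "'a pair_pre_digraph" and v :: 'a
  assumes G: "pair_bidirected_digraph G" "Digraph_Component.connected (with_proj G)"
    and deg: "\<And>x. x \<in> pverts G \<Longrightarrow> deg G x \<ge> 2"
    and v: "v \<in> pverts G"
begin

interpretation pair_bidirected_digraph G by (fact G(1))

lemma countable_V: "countable (pverts G)"
proof (rule countable_pverts[OF G])
  fix x assume "x \<in> pverts G"
  then have "deg G x > 0" using deg[of x] by simp
  then show "finite (neighbours G x)" by (simp add: deg_def card_gt_0_iff)
qed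

lemma prob_space_srw: "x \<in> pverts G \<Longrightarrow>
    prob_space (point_measure (pverts G) (\<lambda>y. ennreal (srw_prob G x y)))"
  using deg[of x] by (intro prob_space_srw_step) (auto intro: pair_wf_digraph_axioms)

lemma Ionescu_Tulcea_srw: "Ionescu_Tulcea (srw_kernel G v) (\<lambda>_. count_space (pverts G))"
  by (rule Ionescu_Tulcea_walk[OF countable_V _ v,
        where F="\<lambda>n x y. point_measure (pverts G) (\<lambda>z. ennreal (srw_prob G y z))"])
     (auto simp: fun_eq_iff sets_point_measure intro: prob_space_srw)

lemma Ionescu_Tulcea_nbrw: "Ionescu_Tulcea (nbrw_kernel G v) (\<lambda>_. count_space (pverts G))"
proof -
  let ?F = "\<lambda>n x y. point_measure (pverts G) (\<lambda>z. ennreal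
      (if n > (0::nat) \<and> (x, y) \<in> parcs G then nbrw_prob G x y z else srw_prob G y z))"
  show ?thesis
  proof (rule Ionescu_Tulcea_walk[where F="?F", OF countable_V _ v])
    show "nbrw_kernel G v 0 = (\<lambda>h. return (count_space (pverts G)) v)" by (simp add: fun_eq_iff)
    show "nbrw_kernel G v (Suc n) = (\<lambda>h. ?F n (h (n - 1)) (h n))" for n
      by (cases n) (simp_all add: fun_eq_iff cong: if_cong)
    show "prob_space (?F n x y) \<and> sets (?F n x y) = Pow (pverts G)"
      if "x \<in> pverts G" "y \<in> pverts G" for n x y
    proof (cases "n > 0 \<and> (x, y) \<in> parcs G")
      case True
      then have "(y, x) \<in> parcs G" using pair_sym_arcs by (auto simp: symmetric_def dest: symD)
      then show ?thesis using True deg[OF that(2)] prob_space_nbrw_step[OF pair_wf_digraph_axioms, of y x]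
        by (simp add: sets_point_measure)
    next
      case False
      then show ?thesis using prob_space_srw[OF that(2)] by (auto simp: sets_point_measure)
    qed
  qed
qed

lemma srw_law_start:
  "prob_space (srw_law G v)"
  "emeasure (srw_law G v) {\<omega> \<in> space (srw_law G v). \<omega> 0 = v} = 1"
  using walk_law_props(1,4)[OF Ionescu_Tulcea_srw] v by (simp_all add: srw_law_def)

lemma srw_law_step:
  assumes x: "\<And>i. x i \<in> pverts G"
  shows "emeasure (srw_law G v) {\<omega> \<in> space (srw_law G v). \<forall>i\<le>Suc n. \<omega> i = x i} =
         emeasure (srw_law G v) {\<omega> \<in> space (srw_law G v). \<forall>i\<le>n. \<omega> i = x i} *
         ennreal (srw_prob G (x n) (x (Suc n)))"
  using walk_law_props(3)[OF Ionescu_Tulcea_srw x] x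
  by (simp add: srw_law_def emeasure_point_measure_singleton)

lemma nbrw_law_start:
  "prob_space (nbrw_law G v)"
  "emeasure (nbrw_law G v) {\<omega> \<in> space (nbrw_law G v). \<omega> 0 = v} = 1"
  using walk_law_props(1,4)[OF Ionescu_Tulcea_nbrw] v by (simp_all add: nbrw_law_def)

lemma nbrw_law_step:
  assumes x: "\<And>i. x i \<in> pverts G"
  shows "emeasure (nbrw_law G v) {\<omega> \<in> space (nbrw_law G v). \<forall>i\<le>Suc n. \<omega> i = x i} =
         emeasure (nbrw_law G v) {\<omega> \<in> space (nbrw_law G v). \<forall>i\<le>n. \<omega> i = x i} *
         ennreal (if n = 0 then srw_prob G (x 0) (x 1) else nbrw_prob G (x (n - 1)) (x n) (x (Suc n)))"
proof -
  let ?E = "\<lambda>n. emeasure (nbrw_law G v) {\<omega> \<in> space (nbrw_law G v). \<forall>i\<le>n. \<omega> i = x i}"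
  have step: "?E (Suc n) = ?E n * emeasure (nbrw_kernel G v (Suc n) (restrict x {0..n})) {x (Suc n)}" for n
    unfolding nbrw_law_def by (rule walk_law_props(3)[OF Ionescu_Tulcea_nbrw x])
  show ?thesis
  proof (cases n)
    case 0
    then show ?thesis using step[of 0] x by (simp add: emeasure_point_measure_singleton)
  next
    case (Suc m)
    have "?E (Suc m) = 0" if "(x m, x (Suc m)) \<notin> parcs G"
      using step[of m] x that
      by (cases m) (auto simp: emeasure_point_measure_singleton srw_prob_def nbrw_prob_def)
    then show ?thesis using step[of n] x Suc
      by (cases "(x m, x (Suc m)) \<in> parcs G") (auto simp: emeasure_point_measure_singleton)
  qed
qed

end

end

theory Submission
  imports Defs
begin

text \<open>
  Let \<open>F(x, y)\<close> be the probability that the non-backtracking walk, sitting at \<open>y\<close> after coming from \<open>x\<close>,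
  hits \<open>v\<close> before leaving a finite set \<open>A\<close>. The antisymmetric function \<open>j(x, y) = F(x, y) - F(y, x)\<close> is
  divergence free on \<open>A - {v}\<close>, and the average \<open>\<phi>(y)\<close> of \<open>F(y, z)\<close> over the neighbours \<open>z\<close> of \<open>y\<close>
  satisfies Ohm's law \<open>\<phi>(y) - \<phi>(x) = r(x, y) j(x, y)\<close> for an explicit resistance \<open>0 \<le> r \<le> 1\<close>. So the
  escape probability of the non-backtracking walk is, up to the factor \<open>deg v\<close>, the effective
  conductance from \<open>v\<close> to the complement of \<open>A\<close> in a network with resistances \<open>r\<close>; simple random walk
  is the case \<open>r = 1\<close>. The resistance is at least \<open>1/6\<close> on every edge having an end of degree at
  least 3 (or an end where the walk is stopped), and on the remaining edges the flow is carried unchanged along a chain of bounded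
  length, so the two conductances are comparable uniformly in \<open>A\<close>. Thus both walks return to \<open>v\<close>
  almost surely or neither does.
\<close>

section \<open>Walks with one step of memory\<close>

text \<open>
  Relative to a uniform choice of the next vertex, the probability of going straight back is lowered by
  \<open>d y\<close>, and the uniform part is raised to total mass \<open>1 + d y\<close>. Simple random walk is \<open>d = 0\<close>,
  non-backtracking walk is \<open>d y = 1 / (deg y - 1)\<close>.
\<close>

locale memory_walk = pair_bidirected_digraph G for G :: "'a pair_pre_digraph" +
  fixes d :: "'a \<Rightarrow> real" and v :: 'a
  assumes deg_ge_2: "\<And>x. x \<in> pverts G \<Longrightarrow> 2 \<le> deg G x"
    and d_nonneg: "\<And>x. x \<in> pverts G \<Longrightarrow> 0 \<le> d x"
    and d_le: "\<And>x. x \<in> pverts G \<Longrightarrow> d x * (real (deg G x) - 1) \<le> 1"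
    and v_in: "v \<in> pverts G"
begin

abbreviation N :: "'a \<Rightarrow> 'a set" where "N \<equiv> neighbours G"

lemma N_sym: "y \<in> N x \<Longrightarrow> x \<in> N y"
  using pair_sym_arcs by (auto simp: neighbours_def symmetric_def dest: symD)

lemma N_irrefl: "x \<notin> N x"
  using pair_no_loops[of "(x, x)"] by (auto simp: neighbours_def)

lemma N_verts: "y \<in> N x \<Longrightarrow> x \<in> pverts G \<and> y \<in> pverts G"
  by (auto simp: neighbours_def dest: in_arcsD1 in_arcsD2)

lemma finite_N: "finite (N x)"
proof (cases "x \<in> pverts G")
  case True
  then have "card (N x) \<noteq> 0" using deg_ge_2[of x] by (simp add: deg_def)
  then show ?thesis by (meson card.infinite)
next
  case False
  then have "N x = {}" using N_verts by blast
  then show ?thesis by simp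
qed

lemma d_le_1: "x \<in> pverts G \<Longrightarrow> d x \<le> 1"
proof -
  assume x: "x \<in> pverts G"
  have "d x * 1 \<le> d x * (real (deg G x) - 1)"
    using d_nonneg[OF x] deg_ge_2[OF x] by (intro mult_left_mono) auto
  then show ?thesis using d_le[OF x] by simp
qed

section \<open>Transition weights\<close>

definition step :: "'a \<Rightarrow> 'a \<Rightarrow> 'a \<Rightarrow> real" where
  "step x y z =
     (if z \<in> N y then (1 + d y) / real (deg G y) - (if z = x then d y else 0) else 0)"

text \<open>The hypothesis \<open>d_le\<close> says exactly that the weight
  \<open>(1 + d y) / deg G y - d y\<close> of going straight back is nonnegative.\<close>

lemma step_nonneg: "0 \<le> step x y z"
proof (cases "z \<in> N y")
  case True
  then have y: "y \<in> pverts G" using N_verts by blast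
  then have "d y * real (deg G y) \<le> 1 + d y" "real (deg G y) > 0"
    using d_le[OF y] deg_ge_2[OF y] by (auto simp: algebra_simps)
  then have "d y \<le> (1 + d y) / real (deg G y)" by (simp add: field_simps)
  then show ?thesis using d_nonneg[OF y] by (auto simp: step_def)
qed (simp add: step_def)

text \<open>Apart from the reversal term, the sum is an average over the neighbours of
  \<open>y\<close> that does not involve \<open>x\<close>. This is what makes a potential on
  vertices possible.\<close>

lemma sum_step:
  assumes "x \<in> N y"
  shows "(\<Sum>z\<in>N y. step x y z * f z) =
    (1 + d y) * ((\<Sum>z\<in>N y. f z) / real (deg G y)) - d y * f x"
proof -
  have "(\<Sum>z\<in>N y. step x y z * f z) =
      (\<Sum>z\<in>N y. (1 + d y) / real (deg G y) * f z - (if z = x then d y * f x else 0))"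
    by (intro sum.cong) (auto simp: step_def algebra_simps)
  also have "\<dots> = (1 + d y) / real (deg G y) * (\<Sum>z\<in>N y. f z) - d y * f x"
    using assms finite_N by (simp add: sum_subtractf sum_distrib_left)
  finally show ?thesis by simp
qed

lemma sum_step_1: "x \<in> N y \<Longrightarrow> (\<Sum>z\<in>N y. step x y z) = 1"
  using sum_step[of x y "\<lambda>_. 1"] deg_ge_2[of y] N_verts[of x y] by (simp add: deg_def)

section \<open>Hitting probabilities, up to a finite time and in the limit\<close>

text \<open>The walk is at \<open>y\<close> and came from \<open>x\<close>; it is stopped on hitting \<open>v\<close> or leaving \<open>A\<close>.\<close>

primrec hit_within :: "'a set \<Rightarrow> nat \<Rightarrow> 'a \<Rightarrow> 'a \<Rightarrow> real" where
  "hit_within A 0 x y = (if y = v then 1 else 0)"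
| "hit_within A (Suc k) x y = (if y = v then 1
     else if y \<in> A then \<Sum>z\<in>N y. step x y z * hit_within A k y z else 0)"

lemma hit_within_nonneg: "0 \<le> hit_within A k x y"
  by (induction k arbitrary: x y) (auto intro!: sum_nonneg mult_nonneg_nonneg step_nonneg)

lemma hit_within_le_1: "x \<in> N y \<Longrightarrow> hit_within A k x y \<le> 1"
proof (induction k arbitrary: x y)
  case (Suc k)
  have "(\<Sum>z\<in>N y. step x y z * hit_within A k y z) \<le> (\<Sum>z\<in>N y. step x y z * 1)"
    by (intro sum_mono mult_left_mono step_nonneg Suc.IH) (rule N_sym)
  then show ?case using sum_step_1[OF Suc.prems] by simp
qed simp

lemma hit_within_mono_Suc: "hit_within A k x y \<le> hit_within A (Suc k) x y"
proof (induction k arbitrary: x y)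
  case 0
  show ?case by (auto intro!: sum_nonneg mult_nonneg_nonneg step_nonneg)
next
  case (Suc k)
  have "(\<Sum>z\<in>N y. step x y z * hit_within A k y z)
      \<le> (\<Sum>z\<in>N y. step x y z * hit_within A (Suc k) y z)"
    by (intro sum_mono mult_left_mono step_nonneg Suc)
  then show ?case
    by (simp only: hit_within.simps(2)[of A k x y] hit_within.simps(2)[of A "Suc k" x y] if_split) auto
qed

lemma hit_within_mono_set: "A \<subseteq> A' \<Longrightarrow> hit_within A k x y \<le> hit_within A' k x y"
proof (induction k arbitrary: x y)
  case (Suc k)
  then show ?case
    using hit_within_nonneg[of A' k]
    by (auto intro!: sum_mono mult_left_mono step_nonneg sum_nonneg mult_nonneg_nonneg)
qed simp

text \<open>Degrees are finite, so \<open>k\<close> steps explore only finitely many vertices, and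
  stopping outside a large finite set goes unnoticed.\<close>

lemma hit_within_local:
  "\<exists>A0. finite A0 \<and> (\<forall>A. A0 \<subseteq> A \<longrightarrow> hit_within A k x y = hit_within UNIV k x y)"
proof (induction k arbitrary: x y)
  case (Suc k)
  then obtain B where B: "\<And>z. finite (B z)"
    "\<And>z A. B z \<subseteq> A \<Longrightarrow> hit_within A k y z = hit_within UNIV k y z" by metis
  have "hit_within A (Suc k) x y = hit_within UNIV (Suc k) x y"
    if "insert y (\<Union>z\<in>N y. B z) \<subseteq> A" for A
  proof -
    have "hit_within A k y z = hit_within UNIV k y z" if "z \<in> N y" for z
      using \<open>insert y _ \<subseteq> A\<close> that by (intro B(2)) auto
    then show ?thesis using \<open>insert y _ \<subseteq> A\<close> by simp
  qed
  moreover have "finite (insert y (\<Union>z\<in>N y. B z))" using B(1) finite_N by simp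
  ultimately show ?case by blast
qed auto

definition hit_prob :: "'a set \<Rightarrow> 'a \<Rightarrow> 'a \<Rightarrow> real" where
  "hit_prob A x y = lim (\<lambda>k. hit_within A k x y)"

text \<open>The sequence is increasing and bounded by 1. Adjacency enters because only then do the
  step weights add up to 1.\<close>

lemma hit_within_tendsto:
  assumes "x \<in> N y"
  shows "(\<lambda>k. hit_within A k x y) \<longlonglongrightarrow> hit_prob A x y"
proof -
  have inc: "incseq (\<lambda>k. hit_within A k x y)"
    by (rule incseq_SucI) (rule hit_within_mono_Suc)
  obtain l where "(\<lambda>k. hit_within A k x y) \<longlonglongrightarrow> l"
    by (rule incseq_convergent[OF inc]) (use hit_within_le_1[OF assms] in blast)
  then show ?thesis by (simp add: hit_prob_def limI)
qed

lemma hit_within_le_hit_prob: "x \<in> N y \<Longrightarrow> hit_within A k x y \<le> hit_prob A x y"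
  by (rule incseq_le[OF _ hit_within_tendsto]) (auto intro!: incseq_SucI hit_within_mono_Suc simp del: hit_within.simps)

lemma hit_prob_le_1: "x \<in> N y \<Longrightarrow> hit_prob A x y \<le> 1"
  by (rule LIMSEQ_le_const2[OF hit_within_tendsto]) (auto intro: hit_within_le_1)

lemma hit_prob_target: "hit_prob A x v = 1"
proof -
  have "hit_within A k x v = 1" for k by (cases k) auto
  then show ?thesis by (simp add: hit_prob_def)
qed

lemma hit_prob_outside: "y \<notin> A \<Longrightarrow> y \<noteq> v \<Longrightarrow> hit_prob A x y = 0"
proof -
  assume "y \<notin> A" "y \<noteq> v"
  then have "hit_within A k x y = 0" for k by (cases k) auto
  then show ?thesis by (simp add: hit_prob_def)
qed

text \<open>First-step analysis in the limit, with the reversal term moved to the left.\<close>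

lemma hit_prob_inside:
  assumes "y \<in> A" "y \<noteq> v" "x \<in> N y"
  shows "hit_prob A x y + d y * hit_prob A y x =
    (1 + d y) * ((\<Sum>z\<in>N y. hit_prob A y z) / real (deg G y))"
proof -
  have "(\<lambda>k. hit_within A (Suc k) x y) \<longlonglongrightarrow> hit_prob A x y"
    by (rule LIMSEQ_Suc[OF hit_within_tendsto[OF assms(3)]])
  moreover have "(\<lambda>k. hit_within A (Suc k) x y) \<longlonglongrightarrow> (\<Sum>z\<in>N y. step x y z * hit_prob A y z)"
    using assms(1,2) by (auto intro!: tendsto_sum tendsto_mult hit_within_tendsto dest: N_sym)
  ultimately have "hit_prob A x y = (\<Sum>z\<in>N y. step x y z * hit_prob A y z)"
    by (rule LIMSEQ_unique)
  then show ?thesis using sum_step[OF assms(3)] by simp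
qed

section \<open>Return to \<open>v\<close> in terms of finite sets\<close>

definition escape :: "'a set \<Rightarrow> real" where
  "escape A = (\<Sum>y\<in>N v. 1 - hit_prob A v y)"

text \<open>Left to right: some horizon \<open>k\<close> makes the deficit small, and
  \<open>hit_within_local\<close> supplies a finite set for it. Right to left: enlarging the set can
  only raise the hitting probability.\<close>

lemma hit_prob_UNIV_eq_1_iff:
  "(\<forall>y\<in>N v. hit_prob UNIV v y = 1) \<longleftrightarrow> (\<forall>\<epsilon>>0. \<exists>A. finite A \<and> escape A < \<epsilon>)"
proof
  assume one: "\<forall>y\<in>N v. hit_prob UNIV v y = 1"
  show "\<forall>\<epsilon>>0. \<exists>A. finite A \<and> escape A < \<epsilon>"
  proof (intro allI impI)
    fix \<epsilon> :: real assume \<epsilon>: "\<epsilon> > 0"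
    have "(\<lambda>k. \<Sum>y\<in>N v. 1 - hit_within UNIV k v y) \<longlonglongrightarrow> (\<Sum>y\<in>N v. 1 - hit_prob UNIV v y)"
      by (intro tendsto_sum tendsto_diff tendsto_const hit_within_tendsto) (rule N_sym)
    then have "\<forall>\<^sub>F k in sequentially. (\<Sum>y\<in>N v. 1 - hit_within UNIV k v y) < \<epsilon>"
      using one \<epsilon> by (intro order_tendstoD(2)) auto
    then obtain k where k: "(\<Sum>y\<in>N v. 1 - hit_within UNIV k v y) < \<epsilon>"
      by (auto simp: eventually_sequentially)
    obtain B where B: "\<And>y. finite (B y)"
      "\<And>y A. B y \<subseteq> A \<Longrightarrow> hit_within A k v y = hit_within UNIV k v y"
      using hit_within_local[of k v] by metis
    define A where "A = (\<Union>y\<in>N v. B y)"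
    have "escape A \<le> (\<Sum>y\<in>N v. 1 - hit_within UNIV k v y)"
      unfolding escape_def
    proof (rule sum_mono)
      fix y assume y: "y \<in> N v"
      have "hit_within UNIV k v y = hit_within A k v y"
        unfolding A_def by (rule B(2)[OF UN_upper[OF y], symmetric])
      also have "\<dots> \<le> hit_prob A v y" by (rule hit_within_le_hit_prob[OF N_sym[OF y]])
      finally show "1 - hit_prob A v y \<le> 1 - hit_within UNIV k v y" by simp
    qed
    moreover have "finite A" using B(1) finite_N by (auto simp: A_def)
    ultimately show "\<exists>A. finite A \<and> escape A < \<epsilon>" using k by force
  qed
next
  assume small: "\<forall>\<epsilon>>0. \<exists>A. finite A \<and> escape A < \<epsilon>"
  show "\<forall>y\<in>N v. hit_prob UNIV v y = 1"
  proof
    fix y assume y: "y \<in> N v"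
    then have vy: "v \<in> N y" by (rule N_sym)
    have "1 \<le> hit_prob UNIV v y + \<epsilon>" if \<epsilon>: "\<epsilon> > 0" for \<epsilon> :: real
    proof -
      obtain A where A: "escape A < \<epsilon>" using small \<epsilon> by blast
      have "1 - hit_prob A v y \<le> escape A"
        unfolding escape_def using y finite_N
        by (intro member_le_sum) (auto intro: hit_prob_le_1 dest: N_sym)
      moreover have "hit_prob A v y \<le> hit_prob UNIV v y"
        by (rule LIMSEQ_le[OF hit_within_tendsto[OF vy] hit_within_tendsto[OF vy]])
           (use hit_within_mono_set[of A UNIV] in auto)
      ultimately show ?thesis using A by simp
    qed
    then have "1 \<le> hit_prob UNIV v y" by (rule field_le_epsilon)
    then show "hit_prob UNIV v y = 1" using hit_prob_le_1[OF vy, of UNIV] by simp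
  qed
qed

end

lemma memory_walk_0:
  assumes "pair_bidirected_digraph G" "\<And>x. x \<in> pverts G \<Longrightarrow> 2 \<le> deg G x" "v \<in> pverts G"
  shows "memory_walk G (\<lambda>_. 0) v"
  using assms by (simp add: memory_walk_def memory_walk_axioms_def)

section \<open>Escape probabilities as effective conductances\<close>

context memory_walk
begin

section \<open>Ohm's law and conservation of flow\<close>

text \<open>
  Dropping the memory where the walk is stopped makes the relation \<open>hit_prob_eq\<close> below hold at every
  vertex, so that no source terms have to be carried along.
\<close>

definition damp :: "'a set \<Rightarrow> 'a \<Rightarrow> real" where
  "damp A x = (if x \<in> A \<and> x \<noteq> v then d x else 0)"

definition pot :: "'a set \<Rightarrow> 'a \<Rightarrow> real" where
  "pot A x = (if x = v then 1
     else if x \<in> A then (\<Sum>z\<in>N x. hit_prob A x z) / real (deg G x) else 0)"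

definition flow :: "'a set \<Rightarrow> 'a \<Rightarrow> 'a \<Rightarrow> real" where
  "flow A x y = hit_prob A x y - hit_prob A y x"

definition res :: "'a set \<Rightarrow> 'a \<Rightarrow> 'a \<Rightarrow> real" where
  "res A x y = (1 - damp A x * damp A y) / ((1 + damp A x) * (1 + damp A y))"

text \<open>Both orientations of an edge occur, whence the factors 2 below; \<open>v\<close> is
  inserted because \<open>A\<close> need not contain it.\<close>

definition edges :: "'a set \<Rightarrow> ('a \<times> 'a) set" where
  "edges A = {(x, y). y \<in> N x \<and> (x \<in> insert v A \<or> y \<in> insert v A)}"

lemma damp_bounds: "x \<in> pverts G \<Longrightarrow> 0 \<le> damp A x \<and> damp A x \<le> 1"
  using d_nonneg d_le_1 by (simp add: damp_def)

lemma hit_prob_eq: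
  assumes "x \<in> N y"
  shows "hit_prob A x y + damp A y * hit_prob A y x = (1 + damp A y) * pot A y"
  using hit_prob_inside[of y A x] assms
  by (auto simp: damp_def pot_def hit_prob_target hit_prob_outside)

text \<open>Ohm's law. The two orientations of the edge give two linear equations in
  \<open>hit_prob A x y\<close> and \<open>hit_prob A y x\<close>; the combination that isolates the
  potentials depends only on the difference of these two.\<close>

lemma pot_diff:
  assumes xy: "x \<in> N y"
  shows "pot A y - pot A x = res A x y * flow A x y"
proof -
  define a b where "a = damp A x" and "b = damp A y"
  have ab: "0 \<le> a" "0 \<le> b" using damp_bounds N_verts[OF xy] by (auto simp: a_def b_def)
  have "((1 + a) * (1 + b)) * (pot A y - pot A x) =
      (1 + a) * ((1 + b) * pot A y) - (1 + b) * ((1 + a) * pot A x)"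
    by (simp add: algebra_simps)
  also have "\<dots> = (1 + a) * (hit_prob A x y + b * hit_prob A y x)
      - (1 + b) * (hit_prob A y x + a * hit_prob A x y)"
    using hit_prob_eq[OF xy, of A] hit_prob_eq[OF N_sym[OF xy], of A] by (simp add: a_def b_def)
  also have "\<dots> = (1 - a * b) * flow A x y"
    by (simp add: flow_def algebra_simps)
  finally have "((1 + a) * (1 + b)) * (pot A y - pot A x) = (1 - a * b) * flow A x y" .
  then have "pot A y - pot A x = (1 - a * b) * flow A x y / ((1 + a) * (1 + b))"
    using ab by (intro eq_divide_imp) (auto simp: mult.commute)
  then show ?thesis by (simp add: res_def a_def b_def)
qed

text \<open>Kirchhoff's node law. Summing \<open>hit_prob_inside\<close> over the neighbours of
  \<open>y\<close> turns the average into \<open>1 + d y\<close> times the outgoing total; the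
  \<open>d y\<close> terms cancel and the incoming and outgoing totals agree.\<close>

lemma flow_divergence:
  assumes "y \<in> A" "y \<noteq> v"
  shows "(\<Sum>x\<in>N y. flow A y x) = 0"
proof (cases "y \<in> pverts G")
  case True
  let ?T = "\<Sum>x\<in>N y. hit_prob A y x"
  have "(\<Sum>x\<in>N y. hit_prob A x y) + d y * ?T =
      (\<Sum>x\<in>N y. hit_prob A x y + d y * hit_prob A y x)"
    by (simp add: sum.distrib sum_distrib_left)
  also have "\<dots> = (\<Sum>x\<in>N y. (1 + d y) * (?T / real (deg G y)))"
    using assms by (intro sum.cong hit_prob_inside) auto
  also have "\<dots> = (1 + d y) * ?T"
    using deg_ge_2[OF True] by (simp add: deg_def)
  finally show ?thesis by (simp add: flow_def sum_subtractf algebra_simps)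
next
  case False
  then have "N y = {}" using N_verts by blast
  then show ?thesis by simp
qed

lemma flow_antisym: "flow A y x = - flow A x y"
  by (simp add: flow_def)

section \<open>Summation over edges and energy\<close>

lemma finite_edges: "finite A \<Longrightarrow> finite (edges A)"
proof (rule finite_subset)
  let ?W = "insert v A \<union> (\<Union>x\<in>insert v A. N x)"
  show "edges A \<subseteq> Sigma ?W N" by (auto simp: edges_def dest: N_sym)
  show "finite A \<Longrightarrow> finite (Sigma ?W N)" using finite_N by (intro finite_SigmaI) auto
qed

lemma edges_swap: "(x, y) \<in> edges A \<longleftrightarrow> (y, x) \<in> edges A"
  by (auto simp: edges_def dest: N_sym)

text \<open>Summation by parts: antisymmetry leaves \<open>f x\<close> times the divergence at
  \<open>x\<close>, which vanishes in \<open>A\<close> except at \<open>v\<close>. Since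
  \<open>f\<close> is free, the flow of one walk can later be paired with the potential of the
  other.\<close>

lemma sum_flow_gradient:
  assumes A: "finite A" and f: "\<And>x. x \<notin> insert v A \<Longrightarrow> f x = 0"
  shows "(\<Sum>(x, y)\<in>edges A. flow A x y * (f y - f x)) = 2 * f v * escape A"
proof -
  let ?B = "insert v A"
  have "(\<Sum>(x, y)\<in>edges A. flow A x y * f y) = (\<Sum>(x, y)\<in>edges A. flow A y x * f x)"
    by (rule sum.reindex_bij_witness[of _ prod.swap prod.swap]) (auto simp: edges_swap)
  also have "\<dots> = - (\<Sum>(x, y)\<in>edges A. flow A x y * f x)"
    by (subst flow_antisym) (simp add: sum_negf split_def)
  finally have 1: "(\<Sum>(x, y)\<in>edges A. flow A x y * (f y - f x)) =
      - 2 * (\<Sum>(x, y)\<in>edges A. flow A x y * f x)"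
    by (simp add: split_def algebra_simps sum_subtractf)
  have "(\<Sum>(x, y)\<in>edges A. flow A x y * f x) = (\<Sum>(x, y)\<in>Sigma ?B N. flow A x y * f x)"
    using finite_edges[OF A] f by (intro sum.mono_neutral_right) (auto simp: edges_def; metis)+
  also have "\<dots> = (\<Sum>x\<in>?B. f x * (\<Sum>y\<in>N x. flow A x y))"
    using A finite_N by (subst sum.Sigma[symmetric]) (auto simp: sum_distrib_left mult.commute)
  also have "\<dots> = (\<Sum>x\<in>{v}. f x * (\<Sum>y\<in>N x. flow A x y))"
    using A flow_divergence by (intro sum.mono_neutral_right) auto
  also have "\<dots> = - f v * escape A"
    by (simp add: escape_def flow_def hit_prob_target sum_subtractf algebra_simps)
  finally show ?thesis using 1 by simp
qed

lemma pot_v: "pot A v = 1"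
  by (simp add: pot_def)

lemma pot_outside: "x \<notin> insert v A \<Longrightarrow> pot A x = 0"
  by (simp add: pot_def)

lemma edgesD: "(x, y) \<in> edges A \<Longrightarrow> x \<in> N y \<and> x \<in> pverts G \<and> y \<in> pverts G"
  using N_sym N_verts by (auto simp: edges_def)

text \<open>The walk's own potential serves as test function, and Ohm's law turns its gradient into
  the flow.\<close>

lemma energy_eq_escape:
  assumes "finite A"
  shows "(\<Sum>(x, y)\<in>edges A. res A x y * (flow A x y)\<^sup>2) = 2 * escape A"
proof -
  have "(\<Sum>(x, y)\<in>edges A. res A x y * (flow A x y)\<^sup>2) =
      (\<Sum>(x, y)\<in>edges A. flow A x y * (pot A y - pot A x))"
    using pot_diff edgesD by (intro sum.cong) (auto simp: power2_eq_square)
  then show ?thesis using sum_flow_gradient[OF assms pot_outside] by (simp add: pot_v)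
qed

section \<open>Bounds on resistances and transport of flow along chains\<close>

lemma res_bounds:
  assumes "x \<in> pverts G" "y \<in> pverts G"
  shows "0 \<le> res A x y" "res A x y \<le> 1"
proof -
  define a b where "a = damp A x" and "b = damp A y"
  have ab: "0 \<le> a" "a \<le> 1" "0 \<le> b" "b \<le> 1"
    using damp_bounds assms by (auto simp: a_def b_def)
  have "a * b \<le> 1" "0 \<le> a * b" using ab by (auto simp: mult_le_one)
  then show "0 \<le> res A x y" "res A x y \<le> 1"
    using ab by (auto simp: res_def a_def[symmetric] b_def[symmetric] divide_le_eq algebra_simps)
qed

text \<open>The damping at \<open>y\<close> is at most 1/2 by \<open>d_le\<close> when the degree is
  at least 3, and 0 where the walk is stopped. Hence the numerator of \<open>res\<close> is at least
  1/2 and the denominator at most 3.\<close>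

lemma res_ge:
  assumes x: "x \<in> pverts G" and y: "y \<in> pverts G" "\<not> (y \<in> A \<and> y \<noteq> v \<and> deg G y = 2)"
  shows "1 / 6 \<le> res A x y"
proof -
  define a b where "a = damp A x" and "b = damp A y"
  have ab: "0 \<le> a" "a \<le> 1" "0 \<le> b"
    using damp_bounds x y(1) by (auto simp: a_def b_def)
  have "b \<le> 1 / 2"
  proof (cases "y \<in> A \<and> y \<noteq> v")
    case True
    then have "deg G y \<ge> 3" using y deg_ge_2[of y] by auto
    then have "d y * 2 \<le> d y * (real (deg G y) - 1)"
      using d_nonneg[OF y(1)] by (intro mult_left_mono) auto
    then show ?thesis using d_le[OF y(1)] True by (simp add: b_def damp_def)
  qed (auto simp: b_def damp_def)
  then have ab2: "a * b \<le> 1 / 2" using ab mult_mono[of a 1 b "1 / 2"] by simp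
  have "(1 + a) * (1 + b) \<le> 2 * (3 / 2)" using ab \<open>b \<le> 1 / 2\<close> by (intro mult_mono) auto
  then have "(1 + a) * (1 + b) \<le> 6 * (1 - a * b)" using ab2 by simp
  moreover have "0 < (1 + a) * (1 + b)" using ab by simp
  ultimately show ?thesis by (simp add: res_def a_def[symmetric] b_def[symmetric] pos_le_divide_eq)
qed

text \<open>At a head of degree 2 the choice is forced: go on without turning back.\<close>

definition next_edge :: "'a \<times> 'a \<Rightarrow> 'a \<times> 'a" where
  "next_edge e = (snd e, SOME z. z \<in> N (snd e) \<and> z \<noteq> fst e)"

text \<open>With just two neighbours, the node law sends all the flow entering \<open>y\<close> out
  along the other edge.\<close>

lemma next_edge:
  assumes e: "(x, y) \<in> edges A" and y: "y \<in> A" "y \<noteq> v" "deg G y = 2"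
  obtains z where "next_edge (x, y) = (y, z)" "z \<noteq> x" "N y = {x, z}" "(y, z) \<in> edges A"
    "flow A y z = flow A x y"
proof -
  define z where "z = (SOME z. z \<in> N y \<and> z \<noteq> x)"
  have x: "x \<in> N y" using edgesD[OF e] by blast
  have "card (N y) = 2" using y(3) by (simp add: deg_def)
  then obtain p q where pq: "N y = {p, q}" "p \<noteq> q" by (meson card_2_iff)
  then have "\<exists>z. z \<in> N y \<and> z \<noteq> x" by auto
  then have z: "z \<in> N y" "z \<noteq> x" unfolding z_def by (metis (mono_tags, lifting) someI_ex)+
  then have Ny: "N y = {x, z}" using pq x by auto
  have "flow A y x + flow A y z = 0" using flow_divergence[OF y(1,2)] z(2) Ny by simp
  then have flow: "flow A y z = flow A x y" using flow_antisym[of A x y] by simp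
  have nxt: "next_edge (x, y) = (y, z)" by (simp add: next_edge_def z_def)
  have "(y, z) \<in> edges A" using z(1) y(1) by (simp add: edges_def)
  then show thesis by (rule that[OF nxt z(2) Ny _ flow])
qed

text \<open>
  The resistance between two vertices of degree 2 may vanish. The flow through such an edge equals the
  flow through the edge at the end of its chain, and pushing edges forward along chains is injective;
  \<open>S k\<close> consists of the edges at \<open>k\<close> steps from the end.
\<close>

lemma sum_flow_square_le:
  assumes A: "finite A"
    and chain: "\<And>xs. (\<And>i. i \<le> M \<Longrightarrow> xs (Suc i) \<in> N (xs i)) \<Longrightarrow>
      (\<And>i. i < M \<Longrightarrow> xs (Suc (Suc i)) \<noteq> xs i) \<Longrightarrow> \<exists>i\<le>M. deg G (xs (Suc i)) \<noteq> 2"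
  shows "(\<Sum>(x, y)\<in>edges A. (flow A x y)\<^sup>2) \<le> 12 * real (Suc M) * escape A"
proof -
  \<comment> \<open>These are exactly the heads to which \<open>res_ge\<close> does not
    apply.\<close>
  define Q where "Q = {y \<in> A. y \<noteq> v \<and> deg G y = 2}"
  define S where "S k = {e \<in> edges A. (\<forall>i<k. snd ((next_edge ^^ i) e) \<in> Q) \<and>
      snd ((next_edge ^^ k) e) \<notin> Q}" for k
  define g where "g e = (flow A (fst e) (snd e))\<^sup>2" for e
  have fin: "finite (edges A)" using finite_edges[OF A] .
  have finS: "finite (S k)" for k using fin by (simp add: S_def)
  have nxt: "next_edge e \<in> edges A" "g (next_edge e) = g e" "snd (next_edge e) \<noteq> fst e"
    "N (snd e) = {fst e, snd (next_edge e)}" "fst (next_edge e) = snd e"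
    if eQ: "e \<in> edges A" "snd e \<in> Q" for e
  proof -
    obtain x y where e: "e = (x, y)" by force
    obtain z where "next_edge (x, y) = (y, z)" "z \<noteq> x" "N y = {x, z}" "(y, z) \<in> edges A"
      "flow A y z = flow A x y"
      using next_edge[of x y A] eQ unfolding e Q_def by auto
    then show "next_edge e \<in> edges A" "g (next_edge e) = g e" "snd (next_edge e) \<noteq> fst e"
      "N (snd e) = {fst e, snd (next_edge e)}" "fst (next_edge e) = snd e"
      by (auto simp: e g_def)
  qed
  have S_Suc: "sum g (S (Suc k)) \<le> sum g (S k)" for k
  proof -
    have in_S: "e \<in> edges A" "snd e \<in> Q" if "e \<in> S (Suc k)" for e
      using that by (auto simp: S_def dest: spec[of _ 0])
    \<comment> \<open>The tail is recovered as the neighbour of the common head to which the next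
      edge does not lead.\<close>
    have inj: "inj_on next_edge (S (Suc k))"
    proof (rule inj_onI)
      fix e e' assume e: "e \<in> S (Suc k)" "e' \<in> S (Suc k)" and eq: "next_edge e = next_edge e'"
      have snd: "snd e = snd e'" using nxt(5)[OF in_S[OF e(1)]] nxt(5)[OF in_S[OF e(2)]] eq by simp
      have "{fst e, snd (next_edge e)} = {fst e', snd (next_edge e)}"
        using nxt(4)[OF in_S[OF e(1)]] nxt(4)[OF in_S[OF e(2)]] snd eq by simp
      then have "fst e = fst e'"
        using nxt(3)[OF in_S[OF e(1)]] nxt(3)[OF in_S[OF e(2)]] eq by auto
      then show "e = e'" using snd by (simp add: prod_eq_iff)
    qed
    have sub: "next_edge ` S (Suc k) \<subseteq> S k"
    proof (rule image_subsetI)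
      fix e assume e: "e \<in> S (Suc k)"
      have "snd ((next_edge ^^ i) (next_edge e)) \<in> Q" if "i < k" for i
        using e that by (auto simp: S_def funpow_swap1 dest!: spec[of _ "Suc i"])
      then show "next_edge e \<in> S k"
        using e nxt(1)[OF in_S[OF e]] by (auto simp: S_def funpow_swap1)
    qed
    have "sum g (S (Suc k)) = (\<Sum>e\<in>S (Suc k). g (next_edge e))"
      using in_S nxt(2) by (intro sum.cong) auto
    also have "\<dots> = sum g (next_edge ` S (Suc k))"
      by (simp add: sum.reindex[OF inj])
    also have "\<dots> \<le> sum g (S k)"
      by (rule sum_mono2[OF finS sub]) (simp add: g_def)
    finally show ?thesis .
  qed
  have S_0: "sum g (S k) \<le> sum g (S 0)" for k
    by (induction k) (auto intro: order_trans[OF S_Suc])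
  \<comment> \<open>Otherwise \<open>M + 1\<close> successive heads lie in \<open>Q\<close> and
    trace a non-backtracking walk forbidden by \<open>chain\<close>.\<close>
  have cover: "\<exists>k\<le>M. e \<in> S k" if e: "e \<in> edges A" for e
  proof (rule ccontr)
    assume no: "\<not> (\<exists>k\<le>M. e \<in> S k)"
    have inQ: "k \<le> M \<Longrightarrow> snd ((next_edge ^^ k) e) \<in> Q" for k
    proof (induction k rule: less_induct)
      case (less k)
      then have "\<forall>i<k. snd ((next_edge ^^ i) e) \<in> Q" by auto
      then show ?case using no e less.prems by (auto simp: S_def)
    qed
    have inE: "k \<le> Suc M \<Longrightarrow> (next_edge ^^ k) e \<in> edges A" for k
      by (induction k) (use e nxt(1) inQ in auto)
    define xs where "xs i = fst ((next_edge ^^ i) e)" for i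
    have xs_Suc: "xs (Suc i) = snd ((next_edge ^^ i) e)" for i
      by (simp add: xs_def next_edge_def)
    have "\<exists>i\<le>M. deg G (xs (Suc i)) \<noteq> 2"
    proof (rule chain)
      fix i assume "i \<le> M"
      then have "(xs i, xs (Suc i)) \<in> edges A" using inE[of i] by (simp add: xs_Suc) (simp add: xs_def)
      then show "xs (Suc i) \<in> N (xs i)" by (simp add: edges_def)
    next
      fix i assume "i < M"
      then show "xs (Suc (Suc i)) \<noteq> xs i"
        using nxt(3)[OF inE inQ, of i] unfolding xs_Suc by (simp add: xs_def)
    qed
    then show False using inQ xs_Suc by (auto simp: Q_def)
  qed
  \<comment> \<open>Every edge lies in one of the \<open>M + 1\<close> layers, and none of these
    weighs more than \<open>S 0\<close>.\<close>
  have "sum g (edges A) \<le> (\<Sum>e\<in>edges A. \<Sum>k\<le>M. if e \<in> S k then g e else 0)"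
  proof (rule sum_mono)
    fix e assume "e \<in> edges A"
    then obtain k where k: "k \<le> M" "e \<in> S k" using cover by blast
    then have "g e = (if e \<in> S k then g e else 0)" by simp
    also have "\<dots> \<le> (\<Sum>k\<le>M. if e \<in> S k then g e else 0)"
      using k by (intro member_le_sum) (auto simp: g_def)
    finally show "g e \<le> (\<Sum>k\<le>M. if e \<in> S k then g e else 0)" .
  qed
  also have "\<dots> = (\<Sum>k\<le>M. \<Sum>e\<in>edges A. if e \<in> S k then g e else 0)"
    by (rule sum.swap)
  also have "\<dots> = (\<Sum>k\<le>M. sum g (S k))"
  proof (rule sum.cong[OF refl])
    fix k
    have "S k = edges A \<inter> S k" by (auto simp: S_def)
    then show "(\<Sum>e\<in>edges A. if e \<in> S k then g e else 0) = sum g (S k)"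
      using sum.inter_restrict[OF fin, of g "S k"] by simp
  qed
  also have "\<dots> \<le> (\<Sum>k\<le>M. sum g (S 0))" by (intro sum_mono S_0)
  also have "\<dots> = real (Suc M) * sum g (S 0)" by simp
  \<comment> \<open>The 6 inverts the lower bound of \<open>res_ge\<close>; with the 2 from
    \<open>energy_eq_escape\<close> it makes the constant 12.\<close>
  also have "\<dots> \<le> real (Suc M) * (6 * (\<Sum>e\<in>S 0. res A (fst e) (snd e) * g e))"
  proof -
    have "g e \<le> 6 * (res A (fst e) (snd e) * g e)" if "e \<in> S 0" for e
    proof -
      have "1 / 6 \<le> res A (fst e) (snd e)"
        using that edgesD[of "fst e" "snd e" A] by (intro res_ge) (auto simp: S_def Q_def)
      then have "1 / 6 * g e \<le> res A (fst e) (snd e) * g e"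
        by (intro mult_right_mono) (auto simp: g_def)
      then show ?thesis by simp
    qed
    then have "sum g (S 0) \<le> 6 * (\<Sum>e\<in>S 0. res A (fst e) (snd e) * g e)"
      by (simp only: sum_distrib_left) (rule sum_mono)
    then show ?thesis by (intro mult_left_mono) auto
  qed
  also have "\<dots> \<le> real (Suc M) * (6 * (\<Sum>e\<in>edges A. res A (fst e) (snd e) * g e))"
  proof (intro mult_left_mono sum_mono2)
    show "0 \<le> res A (fst e) (snd e) * g e" if "e \<in> edges A - S 0" for e
      using that edgesD[of "fst e" "snd e" A] res_bounds(1) by (auto simp: g_def)
  qed (auto simp: fin S_def)
  also have "(\<Sum>e\<in>edges A. res A (fst e) (snd e) * g e) = 2 * escape A"
    using energy_eq_escape[OF A] by (simp add: g_def split_def)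
  finally show ?thesis by (simp add: g_def split_def algebra_simps)
qed

section \<open>Comparison with simple random walk\<close>

interpretation srw: memory_walk G "\<lambda>_. 0" v
  by (rule memory_walk_0[OF pair_bidirected_digraph_axioms deg_ge_2 v_in])

lemma srw_res: "srw.res A x y = 1"
  by (simp add: srw.res_def srw.damp_def)

lemma srw_energy: "finite A \<Longrightarrow> (\<Sum>(x, y)\<in>edges A. (srw.flow A x y)\<^sup>2) = 2 * srw.escape A"
  using srw.energy_eq_escape[of A] by (simp add: srw_res)

text \<open>The simple flow is paired with the potential of the memory walk. As \<open>res\<close>
  lies in [0, 1], its square is at most itself, so the inequality between geometric and arithmetic
  mean bounds the pairing by half the sum of the two energies.\<close>

lemma srw_escape_le:
  assumes A: "finite A"
  shows "srw.escape A \<le> escape A"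
proof -
  let ?i = "srw.flow A" and ?j = "flow A" and ?r = "res A"
  have "2 * srw.escape A = (\<Sum>(x, y)\<in>edges A. ?i x y * (pot A y - pot A x))"
    using srw.sum_flow_gradient[OF A pot_outside] by (simp add: pot_v)
  also have "\<dots> \<le> (\<Sum>(x, y)\<in>edges A. (?i x y)\<^sup>2 / 2 + ?r x y * (?j x y)\<^sup>2 / 2)"
  proof (rule sum_mono, clarify)
    fix x y assume "(x, y) \<in> edges A"
    then have xy: "x \<in> N y" "x \<in> pverts G" "y \<in> pverts G" using edgesD by auto
    have "?i x y * (pot A y - pot A x) = ?i x y * (?r x y * ?j x y)"
      by (simp add: pot_diff[OF xy(1)])
    also have "\<dots> \<le> (?i x y)\<^sup>2 / 2 + (?r x y * ?j x y)\<^sup>2 / 2"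
      using sum_squares_bound[of "?i x y" "?r x y * ?j x y"] by simp
    also have "(?r x y * ?j x y)\<^sup>2 \<le> ?r x y * (?j x y)\<^sup>2"
      using res_bounds[OF xy(2,3), of A]
      by (simp add: power_mult_distrib power2_eq_square[of "res A x y"] mult_right_mono mult_left_le)
    finally show "?i x y * (pot A y - pot A x) \<le> (?i x y)\<^sup>2 / 2 + ?r x y * (?j x y)\<^sup>2 / 2"
      by simp
  qed
  also have "\<dots> = (\<Sum>(x, y)\<in>edges A. (?i x y)\<^sup>2) / 2 + (\<Sum>(x, y)\<in>edges A. ?r x y * (?j x y)\<^sup>2) / 2"
    by (simp add: split_def sum.distrib sum_divide_distrib)
  also have "\<dots> = srw.escape A + escape A"
    by (simp add: srw_energy[OF A] energy_eq_escape[OF A])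
  finally show ?thesis by simp
qed

text \<open>The roles are exchanged: the memory flow is paired with the simple potential, whose
  gradient is the simple flow because its resistances are 1.\<close>

lemma escape_le_srw:
  assumes A: "finite A"
    and chain: "\<And>xs. (\<And>i. i \<le> M \<Longrightarrow> xs (Suc i) \<in> N (xs i)) \<Longrightarrow>
      (\<And>i. i < M \<Longrightarrow> xs (Suc (Suc i)) \<noteq> xs i) \<Longrightarrow> \<exists>i\<le>M. deg G (xs (Suc i)) \<noteq> 2"
  shows "escape A \<le> 12 * real (Suc M) * srw.escape A"
proof -
  let ?i = "srw.flow A" and ?j = "flow A"
  define K where "K = 12 * real (Suc M)"
  have K: "K > 0" by (simp add: K_def)
  have "2 * escape A = (\<Sum>(x, y)\<in>edges A. ?j x y * (srw.pot A y - srw.pot A x))"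
    using sum_flow_gradient[OF A srw.pot_outside] by (simp add: srw.pot_v)
  \<comment> \<open>The weight \<open>K\<close> is such that \<open>sum_flow_square_le\<close>
    bounds the first part by \<open>escape A\<close>, which the left side absorbs.\<close>
  also have "\<dots> \<le> (\<Sum>(x, y)\<in>edges A. (?j x y)\<^sup>2 / K + K / 4 * (?i x y)\<^sup>2)"
  proof (rule sum_mono, clarify)
    fix x y assume "(x, y) \<in> edges A"
    then have "srw.pot A y - srw.pot A x = ?i x y"
      using srw.pot_diff[of x y A] edgesD by (simp add: srw_res)
    moreover have "0 \<le> (?j x y - K / 2 * ?i x y)\<^sup>2 / K" using K by simp
    then have "?j x y * ?i x y \<le> (?j x y)\<^sup>2 / K + K / 4 * (?i x y)\<^sup>2"
      using K by (simp add: power2_diff field_simps power2_eq_square)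
    ultimately show "?j x y * (srw.pot A y - srw.pot A x) \<le> (?j x y)\<^sup>2 / K + K / 4 * (?i x y)\<^sup>2"
      by simp
  qed
  also have "\<dots> = (\<Sum>(x, y)\<in>edges A. (?j x y)\<^sup>2) / K + K / 4 * (\<Sum>(x, y)\<in>edges A. (?i x y)\<^sup>2)"
    by (simp add: split_def sum.distrib sum_divide_distrib sum_distrib_left)
  also have "\<dots> \<le> (K * escape A) / K + K / 4 * (2 * srw.escape A)"
    using sum_flow_square_le[OF A chain] K
    by (intro add_mono divide_right_mono) (auto simp: srw_energy[OF A] K_def)
  also have "\<dots> = escape A + K / 2 * srw.escape A" using K by simp
  finally have "escape A \<le> K / 2 * srw.escape A" by simp
  also have "\<dots> \<le> K * srw.escape A"
  proof -
    have "0 \<le> srw.escape A"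
      unfolding srw.escape_def using srw.hit_prob_le_1 by (intro sum_nonneg) (auto dest: N_sym)
    then show ?thesis using K by (intro mult_right_mono) auto
  qed
  finally show ?thesis by (simp add: K_def)
qed

end

section \<open>Chains of vertices of degree 2\<close>

lemma cas_successive_arcs:
  "pre_digraph.cas (with_proj G) (ys 0) (map (\<lambda>i. (ys i, ys (Suc i))) [0..<m]) (ys m)"
proof (induction m arbitrary: ys)
  case 0
  show ?case by (simp add: pre_digraph.cas.simps)
next
  case (Suc m)
  show ?case
    using Suc.IH[of "\<lambda>i. ys (Suc i)"]
    by (simp add: pre_digraph.cas.simps upt_conv_Cons map_Suc_upt[symmetric] comp_def
        del: upt_Suc)
qed

lemma awalk_verts_successive_arcs:
  "pre_digraph.awalk_verts (with_proj G) (ys 0) (map (\<lambda>i. (ys i, ys (Suc i))) [0..<m]) =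
    map ys [0..<Suc m]"
proof (induction m arbitrary: ys)
  case 0
  show ?case by (simp add: pre_digraph.awalk_verts.simps)
next
  case (Suc m)
  show ?case
    using Suc.IH[of "\<lambda>i. ys (Suc i)"]
    by (simp add: pre_digraph.awalk_verts.simps upt_conv_Cons map_Suc_upt[symmetric] comp_def
        del: upt_Suc)
qed

lemma neighbour_closed_imp_all:
  assumes G: "pair_bidirected_digraph G" "Digraph_Component.connected (with_proj G)"
    and C: "x \<in> C" "x \<in> pverts G" "\<And>y. y \<in> C \<Longrightarrow> neighbours G y \<subseteq> C"
  shows "pverts G \<subseteq> C"
proof
  interpret pair_bidirected_digraph G by (fact G(1))
  fix y assume "y \<in> pverts G"
  moreover have "strongly_connected (with_proj G)"
    using symmetric_connected_imp_strongly_connected[OF pair_sym_arcs G(2)] .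
  ultimately have "x \<rightarrow>\<^sup>*\<^bsub>with_proj G\<^esub> y" using C(2) by (auto simp: strongly_connected_def)
  then have "(x, y) \<in> (parcs G)\<^sup>*" using reachable_rtranclI by fastforce
  then show "y \<in> C"
    by induction (use C in \<open>auto simp: neighbours_def\<close>)
qed

text \<open>
  The vertices of a non-backtracking walk through vertices of degree 2 are distinct, as a first
  repetition would close up a cycle without branch vertices, which would then be all of \<open>G\<close>.
\<close>

lemma (in memory_walk) degree_2_chain_bounded:
  assumes conn: "Digraph_Component.connected (with_proj G)"
    and branch: "x0 \<in> pverts G" "deg G x0 \<noteq> 2"
    and path: "\<And>u p w. pre_digraph.apath (with_proj G) u p w \<Longrightarrow>
      (\<forall>x \<in> set (pre_digraph.awalk_verts (with_proj G) u p). deg G x = 2) \<Longrightarrow> length p < M"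
    and adj: "\<And>i. i \<le> M \<Longrightarrow> xs (Suc i) \<in> N (xs i)"
    and nonback: "\<And>i. i < M \<Longrightarrow> xs (Suc (Suc i)) \<noteq> xs i"
  shows "\<exists>i\<le>M. deg G (xs (Suc i)) \<noteq> 2"
proof (rule ccontr)
  assume "\<not> ?thesis"
  then have deg2: "deg G (xs (Suc i)) = 2" if "i \<le> M" for i using that by blast
  have N_eq: "N (xs (Suc i)) = {xs i, xs (Suc (Suc i))}" if "i < M" for i
  proof (rule card_seteq[symmetric])
    show "{xs i, xs (Suc (Suc i))} \<subseteq> N (xs (Suc i))"
      using that adj[of "Suc i"] N_sym[OF adj[of i]] by auto
    show "card (N (xs (Suc i))) \<le> card {xs i, xs (Suc (Suc i))}"
      using that deg2[of i] nonback[of i] by (simp add: deg_def)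
  qed (rule finite_N)
  have in_V: "xs (Suc i) \<in> pverts G" if "i \<le> M" for i
    using N_verts[OF adj[OF that]] by blast
  \<comment> \<open>The index is shifted because \<open>xs 0\<close> is not known to have degree
    2.\<close>
  have distinct: "inj_on (\<lambda>i. xs (Suc i)) {..j}" if "j \<le> M" for j
    using that
  proof (induction j)
    case (Suc j)
    then have inj: "inj_on (\<lambda>i. xs (Suc i)) {..j}" by simp
    have new: "xs (Suc i) \<noteq> xs (Suc (Suc j))" if i: "i \<le> j" for i
    proof
      assume eq: "xs (Suc i) = xs (Suc (Suc j))"
      have "xs (Suc j) \<in> N (xs (Suc i))"
        using N_sym[OF adj[of "Suc j"]] Suc.prems eq by simp
      \<comment> \<open>The vertex before the repetition is one of the two neighbours of
        \<open>xs (Suc i)\<close>. In the first case the walk closes up a cycle; in the second it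
        stands still or turns back.\<close>
      then consider "xs (Suc j) = xs i" | "xs (Suc j) = xs (Suc (Suc i))"
        using N_eq[of i] i Suc.prems by auto
      then show False
      proof cases
        case 1
        \<comment> \<open>For \<open>i > 0\<close> the equation \<open>1\<close> would be an earlier
          repetition.\<close>
        have "i = 0"
        proof (cases i)
          case (Suc i')
          then show ?thesis using inj_onD[OF inj, of j i'] 1 i by simp
        qed
        define C where "C = (\<lambda>t. xs (Suc t)) ` {..j}"
        have "N (xs (Suc t)) \<subseteq> C" if t: "t \<le> j" for t
        proof -
          have "xs t \<in> C"
          proof (cases t)
            case 0
            then show ?thesis using 1 \<open>i = 0\<close> unfolding C_def by (intro image_eqI[of _ _ j]) auto
          next
            case (Suc t')
            then show ?thesis using t by (auto simp: C_def)
          qed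
          moreover have "xs (Suc (Suc t)) \<in> C"
          proof (cases "t = j")
            case True
            then show ?thesis using eq \<open>i = 0\<close> unfolding C_def by (intro image_eqI[of _ _ 0]) auto
          next
            case False
            then show ?thesis using t by (auto simp: C_def)
          qed
          ultimately show ?thesis using N_eq[of t] t Suc.prems by simp
        qed
        then have "pverts G \<subseteq> C"
          using in_V[of 0]
          by (intro neighbour_closed_imp_all[OF pair_bidirected_digraph_axioms conn, of "xs (Suc 0)"])
             (auto simp: C_def)
        then show False using branch deg2 Suc.prems by (auto simp: C_def)
      next
        case 2
        have "i \<noteq> j"
        proof
          assume "i = j"
          then have "xs (Suc (Suc j)) = xs (Suc j)" using eq by simp
          then show False using adj[of "Suc j"] Suc.prems N_irrefl[of "xs (Suc j)"] by simp
        qed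
        then have "Suc i = j" using inj_onD[OF inj, of j "Suc i"] 2 i by simp
        then show False using nonback[of "Suc i"] eq Suc.prems by simp
      qed
    qed
    show ?case using inj new[symmetric] by (auto simp: atMost_Suc)
  qed simp
  define p where "p = map (\<lambda>i. (xs (Suc i), xs (Suc (Suc i)))) [0..<M]"
  have verts: "pre_digraph.awalk_verts (with_proj G) (xs (Suc 0)) p = map (\<lambda>i. xs (Suc i)) [0..<Suc M]"
    unfolding p_def by (rule awalk_verts_successive_arcs[of _ "\<lambda>i. xs (Suc i)"])
  have "set p \<subseteq> parcs G" using adj by (auto simp: p_def neighbours_def)
  then have "pre_digraph.apath (with_proj G) (xs (Suc 0)) p (xs (Suc M))"
    using cas_successive_arcs[of G "\<lambda>i. xs (Suc i)" M] in_V[of 0] distinct[of M] verts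
    by (simp add: pre_digraph.apath_def pre_digraph.awalk_def p_def[symmetric] distinct_map
        atLeast0LessThan lessThan_Suc_atMost del: upt_Suc)
  moreover have "\<forall>x\<in>set (pre_digraph.awalk_verts (with_proj G) (xs (Suc 0)) p). deg G x = 2"
    unfolding verts using deg2 by auto
  ultimately have "length p < M" by (rule path)
  then show False by (simp add: p_def)
qed

section \<open>Recurrence in terms of escape probabilities\<close>

locale memory_walk_law = memory_walk G d v + prob_space M
  for G :: "'a pair_pre_digraph" and d v and M :: "(nat \<Rightarrow> 'a) measure" +
  assumes countable_verts: "countable (pverts G)"
    and sets_M: "sets M = sets (Pi\<^sub>M UNIV (\<lambda>_. count_space (pverts G)))"
    and start: "prob {\<omega> \<in> space M. \<omega> 0 = v} = 1"
    and law_step: "\<And>x n. (\<And>i. x i \<in> pverts G) \<Longrightarrow>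
      prob {\<omega> \<in> space M. \<forall>i\<le>Suc n. \<omega> i = x i} =
      prob {\<omega> \<in> space M. \<forall>i\<le>n. \<omega> i = x i} *
        (if n = 0 then srw_prob G (x 0) (x 1) else step (x (n - 1)) (x n) (x (Suc n)))"
begin

section \<open>Cylinder events and conditioning on the next step\<close>

definition cyl :: "nat \<Rightarrow> (nat \<Rightarrow> 'a) \<Rightarrow> (nat \<Rightarrow> 'a) set" where
  "cyl n x = {\<omega> \<in> space M. \<forall>i\<le>n. \<omega> i = x i}"

definition avoid :: "nat \<Rightarrow> nat \<Rightarrow> (nat \<Rightarrow> 'a) set" where
  "avoid m n = {\<omega> \<in> space M. \<forall>i\<in>{m..n}. \<omega> i \<noteq> v}"

lemma space_M: "space M = UNIV \<rightarrow> pverts G"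
  using sets_eq_imp_space_eq[OF sets_M] by (auto simp: space_PiM PiE_def)

lemma coordinate_pred [measurable]: "Measurable.pred M (\<lambda>\<omega>. \<omega> i = c)"
proof -
  have 1: "(\<lambda>\<omega>. \<omega> i) \<in> measurable M (count_space (pverts G))"
    unfolding measurable_cong_sets[OF sets_M refl] by (rule measurable_component_singleton) simp
  show ?thesis by (rule measurable_compose[OF 1]) simp
qed

lemma cyl_sets [measurable]: "cyl n x \<in> sets M"
  unfolding cyl_def by measurable

lemma avoid_sets [measurable]: "avoid m n \<in> sets M"
  unfolding avoid_def by measurable

lemma prob_cyl_Suc:
  assumes "\<And>i. x i \<in> pverts G" "1 \<le> n"
  shows "prob (cyl (Suc n) x) = prob (cyl n x) * step (x (n - 1)) (x n) (x (Suc n))"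
  using law_step[of x n, OF assms(1)] assms(2) by (simp add: cyl_def)

text \<open>The one-step extensions to neighbours are disjoint and, as the step weights add up to 1,
  exhaust the cylinder up to a null set.\<close>

lemma prob_cyl_inter:
  assumes x: "\<And>i. x i \<in> pverts G" and n: "1 \<le> n" and adj: "x (n - 1) \<in> N (x n)"
    and E [measurable]: "E \<in> sets M"
  shows "prob (cyl n x \<inter> E) = (\<Sum>z\<in>N (x n). prob (cyl (Suc n) (x(Suc n := z)) \<inter> E))"
proof -
  let ?c = "\<lambda>z. cyl (Suc n) (x(Suc n := z))"
  have sub: "?c z \<subseteq> cyl n x" for z by (auto simp: cyl_def)
  have disj: "disjoint_family_on ?c (N (x n))"
    by (auto simp: disjoint_family_on_def cyl_def)
  have U [measurable]: "(\<Union>z\<in>N (x n). ?c z) \<in> sets M"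
    by (rule sets.finite_UN[OF finite_N]) simp
  have step: "prob (?c z) = prob (cyl n x) * step (x (n - 1)) (x n) z" if "z \<in> N (x n)" for z
  proof -
    have "prob (?c z) = prob (cyl n (x(Suc n := z))) * step (x (n - 1)) (x n) z"
      using prob_cyl_Suc[of "x(Suc n := z)" n] x N_verts[OF that] n by auto
    also have "cyl n (x(Suc n := z)) = cyl n x" by (auto simp: cyl_def)
    finally show ?thesis .
  qed
  have "prob (\<Union>z\<in>N (x n). ?c z) = (\<Sum>z\<in>N (x n). prob (?c z))"
    by (rule finite_measure_finite_Union[OF finite_N _ disj]) auto
  also have "\<dots> = prob (cyl n x) * (\<Sum>z\<in>N (x n). step (x (n - 1)) (x n) z)"
    by (simp add: step sum_distrib_left)
  also have "\<dots> = prob (cyl n x)" using sum_step_1[OF adj] by simp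
  finally have full: "prob (cyl n x - (\<Union>z\<in>N (x n). ?c z)) = 0"
    using sub by (subst finite_measure_Diff) auto
  have "prob (cyl n x \<inter> E) =
      prob ((cyl n x - (\<Union>z\<in>N (x n). ?c z)) \<inter> E \<union> (\<Union>z\<in>N (x n). ?c z \<inter> E))"
    using sub by (intro arg_cong[of _ _ prob]) blast
  also have "\<dots> = prob ((cyl n x - (\<Union>z\<in>N (x n). ?c z)) \<inter> E) + prob (\<Union>z\<in>N (x n). ?c z \<inter> E)"
    using sets.Int[OF U E] by (intro finite_measure_Union sets.Int sets.Diff) auto
  also have "prob ((cyl n x - (\<Union>z\<in>N (x n). ?c z)) \<inter> E) = 0"
  proof -
    have "prob ((cyl n x - (\<Union>z\<in>N (x n). ?c z)) \<inter> E) \<le> prob (cyl n x - (\<Union>z\<in>N (x n). ?c z))"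
      by (intro finite_measure_mono) auto
    then show ?thesis using full measure_nonneg[of M] by (simp add: antisym)
  qed
  also have "prob (\<Union>z\<in>N (x n). ?c z \<inter> E) = (\<Sum>z\<in>N (x n). prob (?c z \<inter> E))"
    using disj by (intro finite_measure_finite_Union[OF finite_N]) (auto simp: disjoint_family_on_def)
  finally show ?thesis by simp
qed

text \<open>Ties the recursively defined \<open>hit_within\<close> to the law. Conditioning on
  entire histories replaces a Markov property; in the induction both \<open>n\<close> and the
  history vary.\<close>

lemma prob_cyl_avoid:
  assumes "\<And>i. x i \<in> pverts G" "1 \<le> n" "x (n - 1) \<in> N (x n)"
  shows "prob (cyl n x \<inter> avoid n (n + k)) =
    prob (cyl n x) * (1 - hit_within UNIV k (x (n - 1)) (x n))"
  using assms
proof (induction k arbitrary: n x)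
  case 0
  have "cyl n x \<inter> avoid n n = (if x n = v then {} else cyl n x)"
    by (auto simp: cyl_def avoid_def)
  then show ?case by simp
next
  case (Suc k)
  show ?case
  proof (cases "x n = v")
    case True
    then have "cyl n x \<inter> avoid n (n + Suc k) = {}" by (auto simp: cyl_def avoid_def)
    then show ?thesis using True by simp
  next
    case False
    have iv: "{n..n + Suc k} = insert n {Suc n..Suc n + k}" by auto
    have "cyl n x \<inter> avoid n (n + Suc k) = cyl n x \<inter> avoid (Suc n) (Suc n + k)"
      using False unfolding cyl_def avoid_def iv by auto
    then have "prob (cyl n x \<inter> avoid n (n + Suc k)) =
        (\<Sum>z\<in>N (x n). prob (cyl (Suc n) (x(Suc n := z)) \<inter> avoid (Suc n) (Suc n + k)))"
      using prob_cyl_inter[OF Suc.prems] by simp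
    also have "\<dots> = (\<Sum>z\<in>N (x n). prob (cyl n x) * step (x (n - 1)) (x n) z *
        (1 - hit_within UNIV k (x n) z))"
    proof (rule sum.cong[OF refl])
      fix z assume z: "z \<in> N (x n)"
      let ?x = "x(Suc n := z)"
      have x: "?x i \<in> pverts G" for i using Suc.prems(1) N_verts[OF z] by simp
      have "cyl n ?x = cyl n x" by (auto simp: cyl_def)
      moreover have "n - 1 \<noteq> Suc n" by simp
      ultimately have "prob (cyl (Suc n) ?x) = prob (cyl n x) * step (x (n - 1)) (x n) z"
        using prob_cyl_Suc[of ?x n] x Suc.prems(2) by simp
      moreover have "prob (cyl (Suc n) ?x \<inter> avoid (Suc n) (Suc n + k)) =
          prob (cyl (Suc n) ?x) * (1 - hit_within UNIV k (?x (Suc n - 1)) (?x (Suc n)))"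
        by (rule Suc.IH[of ?x "Suc n", OF x]) (use N_sym[OF z] in auto)
      ultimately show "prob (cyl (Suc n) ?x \<inter> avoid (Suc n) (Suc n + k)) =
          prob (cyl n x) * step (x (n - 1)) (x n) z * (1 - hit_within UNIV k (x n) z)"
        by simp
    qed
    also have "\<dots> = prob (cyl n x) * ((\<Sum>z\<in>N (x n). step (x (n - 1)) (x n) z) -
        (\<Sum>z\<in>N (x n). step (x (n - 1)) (x n) z * hit_within UNIV k (x n) z))"
      by (simp add: sum_distrib_left sum_subtractf[symmetric] algebra_simps)
    finally show ?thesis using False sum_step_1[OF Suc.prems(3)] by simp
  qed
qed

lemma prob_first_step:
  assumes y: "y \<in> N v"
  shows "prob (cyl 1 (\<lambda>i. if i = 0 then v else y)) = 1 / real (deg G v)"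
proof -
  have "prob (cyl 1 (\<lambda>i. if i = 0 then v else y)) = srw_prob G v y"
    using law_step[of "\<lambda>i. if i = 0 then v else y" 0] v_in N_verts[OF y] start
    by (simp add: cyl_def)
  then show ?thesis using y by (simp add: srw_prob_def neighbours_def)
qed

section \<open>Recurrence and certain return\<close>

text \<open>The events of stepping to \<open>y\<close> and then avoiding \<open>v\<close> for ever
  longer decrease to a null event, and the positive probability of the first step cancels.\<close>

lemma AE_infinitely_often_imp_hit_prob:
  assumes AE: "AE \<omega> in M. infinite {n. \<omega> n = v}" and y: "y \<in> N v"
  shows "hit_prob UNIV v y = 1"
proof -
  define x where "x = (\<lambda>i::nat. if i = 0 then v else y)"
  have x: "x i \<in> pverts G" for i using v_in N_verts[OF y] by (simp add: x_def)
  define E where "E k = cyl 1 x \<inter> avoid 1 (1 + k)" for k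
  have E [measurable]: "E k \<in> sets M" for k by (simp add: E_def)
  have "(\<lambda>k. prob (E k)) \<longlonglongrightarrow> prob (\<Inter>k. E k)"
    by (rule finite_Lim_measure_decseq) (auto simp: E_def avoid_def decseq_def)
  moreover have "prob (\<Inter>k. E k) = 0"
  proof -
    have "AE \<omega> in M. \<omega> \<notin> (\<Inter>k. E k)"
      using AE
    proof eventually_elim
      case (elim \<omega>)
      then obtain n where "n > 0" "\<omega> n = v"
        using infinite_nat_iff_unbounded[of "{n. \<omega> n = v}"] by auto
      then have "\<omega> \<notin> E n" by (auto simp: E_def avoid_def)
      then show ?case by blast
    qed
    then show ?thesis by (intro prob_eq_0[THEN iffD2]) auto
  qed
  moreover have "prob (E k) = 1 / real (deg G v) * (1 - hit_within UNIV k v y)" for k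
    using prob_cyl_avoid[of x 1 k, OF x] prob_first_step[OF y] N_sym[OF y] by (simp add: E_def x_def)
  moreover have "(\<lambda>k. 1 / real (deg G v) * (1 - hit_within UNIV k v y)) \<longlonglongrightarrow>
      1 / real (deg G v) * (1 - hit_prob UNIV v y)"
    by (intro tendsto_intros hit_within_tendsto N_sym[OF y])
  ultimately have "1 / real (deg G v) * (1 - hit_prob UNIV v y) = 0"
    using LIMSEQ_unique by force
  then show ?thesis using deg_ge_2[OF v_in] by simp
qed

text \<open>Once the walk has stepped from \<open>v\<close> to a neighbour, its return probability
  depends on that neighbour alone, whatever the earlier history.\<close>

lemma prob_last_visit_eq_0:
  assumes hit: "\<And>y. y \<in> N v \<Longrightarrow> hit_prob UNIV v y = 1"
    and x: "\<And>i. x i \<in> pverts G" and xm: "x m = v"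
  shows "prob (cyl (Suc m) x \<inter> {\<omega> \<in> space M. \<forall>i>m. \<omega> i \<noteq> v}) = 0"
proof (cases "x (Suc m) \<in> N v")
  case True
  let ?E = "cyl (Suc m) x \<inter> {\<omega> \<in> space M. \<forall>i>m. \<omega> i \<noteq> v}"
  have "prob ?E \<le> prob (cyl (Suc m) x) * (1 - hit_within UNIV k v (x (Suc m)))" for k
  proof -
    have "?E \<subseteq> cyl (Suc m) x \<inter> avoid (Suc m) (Suc m + k)"
      by (auto simp: avoid_def Suc_le_eq)
    then have "prob ?E \<le> prob (cyl (Suc m) x \<inter> avoid (Suc m) (Suc m + k))"
      by (rule finite_measure_mono) simp
    then show ?thesis using prob_cyl_avoid[of x "Suc m" k, OF x] N_sym[OF True] xm by simp
  qed
  moreover have "(\<lambda>k. prob (cyl (Suc m) x) * (1 - hit_within UNIV k v (x (Suc m))))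
      \<longlonglongrightarrow> prob (cyl (Suc m) x) * (1 - hit_prob UNIV v (x (Suc m)))"
    by (intro tendsto_intros hit_within_tendsto N_sym[OF True])
  ultimately have "prob ?E \<le> prob (cyl (Suc m) x) * (1 - hit_prob UNIV v (x (Suc m)))"
    by (intro LIMSEQ_le_const) auto
  then show ?thesis using hit[OF True] measure_nonneg[of M ?E] by simp
next
  case False
  have "prob (cyl (Suc m) x) = 0"
    using law_step[of x m, OF x] False xm by (auto simp: cyl_def step_def srw_prob_def neighbours_def)
  moreover have "prob (cyl (Suc m) x \<inter> {\<omega> \<in> space M. \<forall>i>m. \<omega> i \<noteq> v}) \<le> prob (cyl (Suc m) x)"
    by (intro finite_measure_mono) auto
  ultimately show ?thesis
    using measure_nonneg[of M "cyl (Suc m) x \<inter> {\<omega> \<in> space M. \<forall>i>m. \<omega> i \<noteq> v}"]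
    by linarith
qed

text \<open>Finitely many visits would include a last one. For each time \<open>m\<close> of it,
  countability of the vertices leaves only countably many histories up to \<open>m + 1\<close>, each
  contributing a null event.\<close>

lemma hit_prob_imp_AE_infinitely_often:
  assumes hit: "\<And>y. y \<in> N v \<Longrightarrow> hit_prob UNIV v y = 1"
  shows "AE \<omega> in M. infinite {n. \<omega> n = v}"
proof -
  have no_last: "AE \<omega> in M. \<not> (\<omega> m = v \<and> (\<forall>i>m. \<omega> i \<noteq> v))" for m
  proof -
    let ?F = "PiE {..Suc m} (\<lambda>_. pverts G)"
    let ?ext = "\<lambda>h i. if i \<le> Suc m then h i else v"
    have "AE \<omega> in M. \<forall>h\<in>?F. h m = v \<longrightarrow>
        \<omega> \<notin> cyl (Suc m) (?ext h) \<inter> {\<omega> \<in> space M. \<forall>i>m. \<omega> i \<noteq> v}"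
    proof (rule AE_ball_countable')
      show "countable ?F" using countable_verts by (intro countable_PiE) auto
      fix h assume h: "h \<in> ?F"
      show "AE \<omega> in M. h m = v \<longrightarrow>
          \<omega> \<notin> cyl (Suc m) (?ext h) \<inter> {\<omega> \<in> space M. \<forall>i>m. \<omega> i \<noteq> v}"
      proof (cases "h m = v")
        case True
        have "prob (cyl (Suc m) (?ext h) \<inter> {\<omega> \<in> space M. \<forall>i>m. \<omega> i \<noteq> v}) = 0"
          using h v_in True by (intro prob_last_visit_eq_0[OF hit]) (auto simp: PiE_iff)
        then show ?thesis by (subst (asm) prob_eq_0) auto
      qed simp
    qed
    then show ?thesis using AE_space
    proof eventually_elim
      case (elim \<omega>)
      let ?h = "restrict \<omega> {..Suc m}"
      have "?h \<in> ?F" using elim(2) by (auto simp: space_M)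
      moreover have "\<omega> \<in> cyl (Suc m) (?ext ?h)" using elim(2) by (simp add: cyl_def)
      ultimately have "\<not> (?h m = v \<and> \<omega> \<in> {\<omega> \<in> space M. \<forall>i>m. \<omega> i \<noteq> v})"
        using elim(1) by blast
      then show ?case using elim(2) by simp
    qed
  qed
  have "AE \<omega> in M. \<omega> 0 = v"
    using start by (subst (asm) prob_Collect_eq_1) auto
  moreover have "AE \<omega> in M. \<forall>m. \<not> (\<omega> m = v \<and> (\<forall>i>m. \<omega> i \<noteq> v))"
    using no_last by (subst AE_all_countable) blast
  ultimately show ?thesis
  proof eventually_elim
    case (elim \<omega>)
    show ?case
    proof
      assume fin: "finite {n. \<omega> n = v}"
      have "Max {n. \<omega> n = v} \<in> {n. \<omega> n = v}" using elim(1) fin by (intro Max_in) auto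
      then obtain i where "Max {n. \<omega> n = v} < i" "\<omega> i = v" using elim(2) by blast
      then show False using Max_ge[OF fin, of i] by simp
    qed
  qed
qed

lemma recurrent_iff_escape:
  "(AE \<omega> in M. infinite {n. \<omega> n = v}) \<longleftrightarrow> (\<forall>\<epsilon>>0. \<exists>A. finite A \<and> escape A < \<epsilon>)"
  using AE_infinitely_often_imp_hit_prob hit_prob_imp_AE_infinitely_often
  unfolding hit_prob_UNIV_eq_1_iff[symmetric] by blast

end

section \<open>Comparison of the two walks\<close>

lemma memory_walk_nbrw:
  assumes "pair_bidirected_digraph G" "\<And>x. x \<in> pverts G \<Longrightarrow> 2 \<le> deg G x" "v \<in> pverts G"
  shows "memory_walk G (\<lambda>x. 1 / (real (deg G x) - 1)) v"
proof -
  have "real (deg G x) - 1 > 0" if "x \<in> pverts G" for x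
    using assms(2)[OF that] by simp
  then show ?thesis using assms by (simp add: memory_walk_def memory_walk_axioms_def less_imp_le)
qed

lemma memory_walk_law_srw:
  assumes G: "pair_bidirected_digraph G" "Digraph_Component.connected (with_proj G)"
    and deg: "\<And>x. x \<in> pverts G \<Longrightarrow> 2 \<le> deg G x" and v: "v \<in> pverts G"
  shows "memory_walk_law G (\<lambda>_. 0) v (srw_law G v)"
proof -
  interpret memory_walk G "\<lambda>_. 0" v
    by (rule memory_walk_0[OF G(1) deg v])
  interpret prob_space "srw_law G v"
    by (rule srw_law_start(1)[OF G deg v])
  show ?thesis
  proof
    show "countable (pverts G)" by (rule countable_V[OF G deg v])
    show "sets (srw_law G v) = sets (Pi\<^sub>M UNIV (\<lambda>_. count_space (pverts G)))"
      unfolding srw_law_def by (rule walk_law_props(2)[OF Ionescu_Tulcea_srw[OF G deg v]])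
    show "prob {\<omega> \<in> space (srw_law G v). \<omega> 0 = v} = 1"
      by (simp add: measure_def srw_law_start(2)[OF G deg v])
  next
    fix x :: "nat \<Rightarrow> 'a" and n assume x: "\<And>i. x i \<in> pverts G"
    have "step (x (n - 1)) (x n) (x (Suc n)) = srw_prob G (x n) (x (Suc n))"
      by (simp add: step_def srw_prob_def neighbours_def)
    moreover have "0 \<le> srw_prob G (x n) (x (Suc n))" by (simp add: srw_prob_def)
    ultimately show "prob {\<omega> \<in> space (srw_law G v). \<forall>i\<le>Suc n. \<omega> i = x i} =
        prob {\<omega> \<in> space (srw_law G v). \<forall>i\<le>n. \<omega> i = x i} *
        (if n = 0 then srw_prob G (x 0) (x 1) else step (x (n - 1)) (x n) (x (Suc n)))"
      using arg_cong[of _ _ enn2real, OF srw_law_step[where x=x and n=n, OF G deg v x]]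
      by (auto simp: measure_def enn2real_mult)
  qed
qed

lemma memory_walk_law_nbrw:
  assumes G: "pair_bidirected_digraph G" "Digraph_Component.connected (with_proj G)"
    and deg: "\<And>x. x \<in> pverts G \<Longrightarrow> 2 \<le> deg G x" and v: "v \<in> pverts G"
  shows "memory_walk_law G (\<lambda>x. 1 / (real (deg G x) - 1)) v (nbrw_law G v)"
proof -
  interpret memory_walk G "\<lambda>x. 1 / (real (deg G x) - 1)" v
    by (rule memory_walk_nbrw[OF G(1) deg v])
  interpret prob_space "nbrw_law G v"
    by (rule nbrw_law_start(1)[OF G deg v])
  show ?thesis
  proof
    show "countable (pverts G)" by (rule countable_V[OF G deg v])
    show "sets (nbrw_law G v) = sets (Pi\<^sub>M UNIV (\<lambda>_. count_space (pverts G)))"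
      unfolding nbrw_law_def by (rule walk_law_props(2)[OF Ionescu_Tulcea_nbrw[OF G deg v]])
    show "prob {\<omega> \<in> space (nbrw_law G v). \<omega> 0 = v} = 1"
      by (simp add: measure_def nbrw_law_start(2)[OF G deg v])
  next
    fix x :: "nat \<Rightarrow> 'a" and n assume x: "\<And>i. x i \<in> pverts G"
    let ?s = "step (x (n - 1)) (x n) (x (Suc n))"
    \<comment> \<open>With this \<open>d\<close> the uniform part is \<open>1 / (deg - 1)\<close>,
      and the reversal term cancels it exactly.\<close>
    have "real (deg G (x n)) - 1 > 0" using deg[OF x, of n] by simp
    then have "(1 + 1 / (real (deg G (x n)) - 1)) / real (deg G (x n)) = 1 / (real (deg G (x n)) - 1)"
      by (simp add: field_simps)
    then have "?s = nbrw_prob G (x (n - 1)) (x n) (x (Suc n))"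
      by (auto simp: step_def nbrw_prob_def neighbours_def)
    moreover have "0 \<le> ?s" by (rule step_nonneg)
    moreover have "0 \<le> srw_prob G (x 0) (x 1)" by (simp add: srw_prob_def)
    ultimately show "prob {\<omega> \<in> space (nbrw_law G v). \<forall>i\<le>Suc n. \<omega> i = x i} =
        prob {\<omega> \<in> space (nbrw_law G v). \<forall>i\<le>n. \<omega> i = x i} *
        (if n = 0 then srw_prob G (x 0) (x 1) else ?s)"
      using arg_cong[of _ _ enn2real, OF nbrw_law_step[where x=x and n=n, OF G deg v x]]
      by (auto simp: measure_def enn2real_mult)
  qed
qed

text \<open>The comparison constant does not depend on \<open>A\<close>, so one escape quantity gets
  arbitrarily small over finite sets exactly when the other does.\<close>

lemma nbrw_AE_infinitely_often_iff_srw: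
  assumes G: "pair_bidirected_digraph G" "Digraph_Component.connected (with_proj G)"
    and deg: "\<And>x. x \<in> pverts G \<Longrightarrow> 2 \<le> deg G x" and v: "v \<in> pverts G"
    and branch: "x0 \<in> pverts G" "deg G x0 \<noteq> 2"
    and path: "\<And>u p w. pre_digraph.apath (with_proj G) u p w \<Longrightarrow>
      (\<forall>x \<in> set (pre_digraph.awalk_verts (with_proj G) u p). deg G x = 2) \<Longrightarrow> length p < M"
  shows "(AE \<omega> in nbrw_law G v. infinite {n. \<omega> n = v}) \<longleftrightarrow>
    (AE \<omega> in srw_law G v. infinite {n. \<omega> n = v})"
proof -
  let ?d = "\<lambda>x. 1 / (real (deg G x) - 1)"
  interpret srw: memory_walk_law G "\<lambda>_. 0" v "srw_law G v"
    by (rule memory_walk_law_srw[OF G deg v])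
  interpret nbrw: memory_walk_law G ?d v "nbrw_law G v"
    by (rule memory_walk_law_nbrw[OF G deg v])
  define K where "K = 12 * real (Suc M)"
  have K: "K > 0" by (simp add: K_def)
  have le: "srw.escape A \<le> nbrw.escape A" if "finite A" for A
    by (rule nbrw.srw_escape_le[OF that])
  have ge: "nbrw.escape A \<le> K * srw.escape A" if "finite A" for A
    unfolding K_def
    by (rule nbrw.escape_le_srw[OF that]) (rule nbrw.degree_2_chain_bounded[OF G(2) branch path])
  have "(\<forall>\<epsilon>>0. \<exists>A. finite A \<and> nbrw.escape A < \<epsilon>) \<longleftrightarrow>
      (\<forall>\<epsilon>>0. \<exists>A. finite A \<and> srw.escape A < \<epsilon>)"
  proof (intro iffI allI impI)
    fix \<epsilon> :: real assume "\<epsilon> > 0" "\<forall>\<epsilon>>0. \<exists>A. finite A \<and> nbrw.escape A < \<epsilon>"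
    then show "\<exists>A. finite A \<and> srw.escape A < \<epsilon>" using le by (meson le_less_trans)
  next
    fix \<epsilon> :: real assume \<epsilon>: "\<epsilon> > 0" and "\<forall>\<epsilon>>0. \<exists>A. finite A \<and> srw.escape A < \<epsilon>"
    moreover have "\<epsilon> / K > 0" using \<epsilon> K by simp
    ultimately obtain A where A: "finite A" "srw.escape A < \<epsilon> / K" by blast
    then have "K * srw.escape A < \<epsilon>" using K by (simp add: field_simps)
    then show "\<exists>A. finite A \<and> nbrw.escape A < \<epsilon>" using A(1) ge le_less_trans by blast
  qed
  then show ?thesis by (simp only: nbrw.recurrent_iff_escape srw.recurrent_iff_escape)
qed

theorem proposition3:
  fixes G :: "'a pair_pre_digraph" and k1 k2 :: nat and L :: real
  assumes "pair_bidirected_digraph G"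
    and "Digraph_Component.connected (with_proj G)"
    and "2 < k1" and "k1 < k2"
    and "\<forall>x \<in> pverts G. deg G x \<in> {2, k1, k2}"
    and "L > 0"
    and "\<forall>u p w. pre_digraph.apath (with_proj G) u p w \<and>
           (\<forall>x \<in> set (pre_digraph.awalk_verts (with_proj G) u p). deg G x = 2)
           \<longrightarrow> real (length p) \<le> L"
    and "infinite (pverts (branch_graph G))"
    and "\<forall>x \<in> pverts (branch_graph G). deg (branch_graph G) x \<in> {k1, k2}"
    and "\<forall>x \<in> pverts (branch_graph G). deg (branch_graph G) x = k1 \<longrightarrow>
           (\<forall>y \<in> neighbours (branch_graph G) x. deg (branch_graph G) y = k2)"
    and "\<forall>x \<in> pverts (branch_graph G). deg (branch_graph G) x = k2 \<longrightarrow>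
           (\<forall>y \<in> neighbours (branch_graph G) x. deg (branch_graph G) y = k1)"
  shows "nbrw_recurrent G \<longleftrightarrow> srw_recurrent G"
proof -
  have deg: "2 \<le> deg G x" if "x \<in> pverts G" for x
    using assms(3-5) that by fastforce
  \<comment> \<open>A branch vertex rules out that \<open>G\<close> is a cycle of vertices of degree
    2.\<close>
  have "pverts (branch_graph G) \<noteq> {}"
    using assms(8) by (metis finite.emptyI)
  then obtain x0 where x0: "x0 \<in> pverts G" "deg G x0 \<noteq> 2"
    by (auto simp: branch_graph_def Let_def)
  have path: "length p < Suc (nat \<lceil>L\<rceil>)"
    if "pre_digraph.apath (with_proj G) u p w"
      "\<forall>x \<in> set (pre_digraph.awalk_verts (with_proj G) u p). deg G x = 2" for u p w
  proof -
    have "real (length p) \<le> L" using assms(7) that by blast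
    then show ?thesis by linarith
  qed
  show ?thesis
    unfolding nbrw_recurrent_def srw_recurrent_def
    by (rule ball_cong[OF refl]) (rule nbrw_AE_infinitely_often_iff_srw[OF assms(1,2) deg _ x0 path])
qed

end
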